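(* Let $\mu$ be a probability measure on $E=\mathbb{R}^n$ and $L$ a $\mu$-symmetric diffusion operator with algebra $\mathcal{A}$ and carré du champ $\Gamma$. Suppose that there exist some sublinear ($C^1$, positive, increasing) function $\phi:[1,\infty)\to\mathbb{R}^+$, a smooth enough function $W\ge 1$, and constants $b>0$, $R>0$ such that $$LW\le -\phi(W)+b\,\mathbf{1}_{\{|x|\le R\}} .$$ Suppose also that $\mu$ satisfies a local Poincaré inequality: there exists $\kappa_R$ such that for all nice functions $f$ $$\int_{|x|\le R} f^2\,d\mu\;\le\; \kappa_R\int\Gamma(f)\,d\mu+\mu(\{|x|\le R\})^{-1}\Big(\int_{|x|\le R} f\,d\mu\Big)^2 .$$ Then: (1) for all nice $f$, the following weighted Poincaré inequality holds: $$\mathrm{Var}_\mu(f)\le \max\Big(\frac{b\kappa_R}{\phi(1)},1\Big)\int\Big(1+\frac{1}{\phi'(W)}\Big)\Gamma(f)\,d\mu ;$$ (2) for all nice $f$, the following converse weighted Poincaré inequality holds: $$\inf_{c}\int (f-c)^2\,\frac{\phi(W)}{W}\,d\mu\le (1+b\kappa_R)\int\Gamma(f)\,d\mu ;$$ (3) define $F(u)=\mu(\phi(W)<uW)$ and, for $0<s<1$, $F^{-1}(s):=\inf\{u: F(u)>s\}$; then the following weak Poincaré inequality holds, for some constant $C$, for all such $s$ and all nice $f$: $$\mathrm{Var}_\mu(f)\le \frac{C}{F^{-1}(s)}\int\Gamma(f)\,d\mu+s\,\mathrm{Osc}_\mu(f)^2 .$$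
   Context: Setting: $L$ is a $\mu$-symmetric operator, and there is an algebra $\mathcal{A}$ of bounded functions (the "nice" functions), containing the constant functions, which is everywhere dense (in the $L^2(\mu)$ norm) in the domain of $L$. The carré du champ is defined for $f,g\in\mathcal{A}$ by $L(fg)=fLg+gLf+2\Gamma(f,g)$, with $\Gamma(f):=\Gamma(f,f)$; it is assumed to be a derivation in each component (diffusion case), so that the chain rule $\Gamma(\Psi(f),\Phi(g))=\Psi'(f)\Phi'(g)\Gamma(f,g)$ holds. The main case is $\mu(dx)=Ze^{-V(x)}dx$ with $V$ smooth and $Z$ a normalizing constant, $L=\Delta-\nabla V\cdot\nabla$, $\mathcal{A}$ the $C^\infty$ compactly supported functions plus constants, and $\Gamma(f,g)=\nabla f\cdot\nabla g$. $|x|$ is the Euclidean norm, $\mathrm{Var}_\mu(f)=\int f^2d\mu-(\int f\,d\mu)^2$, and $\mathrm{Osc}_\mu(f)$ is the oscillation of $f$, i.e. its ($\mu$-essential) supremum minus its infimum. The infimum in (2) is over real constants $c$. *)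

theory Defs
  imports "HOL-Probability.Probability" "HOL-Library.Landau_Symbols"
begin

definition carre_du_champ :: "(('a \<Rightarrow> real) \<Rightarrow> 'a \<Rightarrow> real) \<Rightarrow> ('a \<Rightarrow> real) \<Rightarrow> ('a \<Rightarrow> real) \<Rightarrow> 'a \<Rightarrow> real"
  where "carre_du_champ L f g x = (L (\<lambda>y. f y * g y) x - f x * L g x - g x * L f x) / 2"

definition smooth_real :: "(real \<Rightarrow> real) \<Rightarrow> bool"
  where "smooth_real \<Psi> \<longleftrightarrow> (\<forall>k::nat. \<forall>t. ((deriv ^^ k) \<Psi>) differentiable (at t))"

text \<open>
  \<open>L\<close> is an operator on $L^2(\mu)$ with domain \<open>D\<close>, and \<open>\<A>\<close> is its algebra of nice functions.
  The domain consists of actual functions and not of classes, so identities involving \<open>L\<close> are only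
  required almost everywhere. The nonnegativity of the carre du champ is part of \<open>L\<close> being a
  diffusion operator (rather than the opposite of one). The chain rule is required for
  $C^\infty$ functions only, because the algebra of $C^\infty$ compactly supported functions plus
  constants is not stable under less regular ones.
\<close>

locale symmetric_diffusion = prob_space \<mu>
  for \<mu> :: "(real ^ 'n) measure" +
  fixes D :: "(real ^ 'n \<Rightarrow> real) set"
    and \<A> :: "(real ^ 'n \<Rightarrow> real) set"
    and L :: "(real ^ 'n \<Rightarrow> real) \<Rightarrow> real ^ 'n \<Rightarrow> real"
  assumes sets_eq_borel: "sets \<mu> = sets borel"
    and dom_measurable: "f \<in> D \<Longrightarrow> f \<in> borel_measurable \<mu>"
    and dom_L2: "f \<in> D \<Longrightarrow> integrable \<mu> (\<lambda>x. (f x)\<^sup>2)"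
    and L_measurable: "f \<in> D \<Longrightarrow> L f \<in> borel_measurable \<mu>"
    and L_L2: "f \<in> D \<Longrightarrow> integrable \<mu> (\<lambda>x. (L f x)\<^sup>2)"
    and dom_add: "f \<in> D \<Longrightarrow> g \<in> D \<Longrightarrow> (\<lambda>x. f x + g x) \<in> D"
    and dom_scale: "f \<in> D \<Longrightarrow> (\<lambda>x. c * f x) \<in> D"
    and L_cong_AE: "f \<in> D \<Longrightarrow> g \<in> D \<Longrightarrow> AE x in \<mu>. f x = g x \<Longrightarrow> AE x in \<mu>. L f x = L g x"
    and L_add: "f \<in> D \<Longrightarrow> g \<in> D \<Longrightarrow> AE x in \<mu>. L (\<lambda>y. f y + g y) x = L f x + L g x"
    and L_scale: "f \<in> D \<Longrightarrow> AE x in \<mu>. L (\<lambda>y. c * f y) x = c * L f x"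
    and L_symmetric: "f \<in> D \<Longrightarrow> g \<in> D \<Longrightarrow> (\<integral>x. f x * L g x \<partial>\<mu>) = (\<integral>x. g x * L f x \<partial>\<mu>)"
    and alg_subset: "\<A> \<subseteq> D"
    and alg_bounded: "f \<in> \<A> \<Longrightarrow> \<exists>K. \<forall>x. \<bar>f x\<bar> \<le> K"
    and alg_const: "(\<lambda>x. c) \<in> \<A>"
    and alg_add: "f \<in> \<A> \<Longrightarrow> g \<in> \<A> \<Longrightarrow> (\<lambda>x. f x + g x) \<in> \<A>"
    and alg_mult: "f \<in> \<A> \<Longrightarrow> g \<in> \<A> \<Longrightarrow> (\<lambda>x. f x * g x) \<in> \<A>"
    and alg_dense: "f \<in> D \<Longrightarrow> \<epsilon> > 0 \<Longrightarrow> \<exists>g\<in>\<A>. (\<integral>x. (f x - g x)\<^sup>2 \<partial>\<mu>) < \<epsilon>"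
    and gamma_nonneg: "f \<in> \<A> \<Longrightarrow> AE x in \<mu>. 0 \<le> carre_du_champ L f f x"
    and gamma_derivation: "f \<in> \<A> \<Longrightarrow> g \<in> \<A> \<Longrightarrow> h \<in> \<A> \<Longrightarrow>
      AE x in \<mu>. carre_du_champ L (\<lambda>y. f y * g y) h x =
        f x * carre_du_champ L g h x + g x * carre_du_champ L f h x"
    and alg_smooth: "f \<in> \<A> \<Longrightarrow> smooth_real \<Psi> \<Longrightarrow> (\<lambda>x. \<Psi> (f x)) \<in> \<A>"
    and gamma_chain: "f \<in> \<A> \<Longrightarrow> g \<in> \<A> \<Longrightarrow> smooth_real \<Psi> \<Longrightarrow> smooth_real \<Phi> \<Longrightarrow>
      AE x in \<mu>. carre_du_champ L (\<lambda>y. \<Psi> (f y)) (\<lambda>y. \<Phi> (g y)) x =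
        deriv \<Psi> (f x) * deriv \<Phi> (g x) * carre_du_champ L f g x"

definition C2_truncation :: "(real \<Rightarrow> real) \<Rightarrow> (real \<Rightarrow> real) \<Rightarrow> (real \<Rightarrow> real) \<Rightarrow> bool"
  where "C2_truncation T T' T'' \<longleftrightarrow>
    (\<forall>t. (T has_real_derivative T' t) (at t)) \<and>
    (\<forall>t. (T' has_real_derivative T'' t) (at t)) \<and>
    continuous_on UNIV T'' \<and> (\<exists>M. \<forall>t\<ge>M. T' t = 0)"

text \<open>
  A Lyapunov function \<open>W\<close> is typically unbounded and not even in $L^2(\mu)$, so \<open>L W\<close> has to be
  understood in an extended sense: \<open>W\<close> is smooth enough, with image \<open>LW\<close>, if for each $C^2$
  function \<open>T\<close> that is constant near infinity, the bounded function $T(W)$ is a limit of nice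
  functions along which \<open>L\<close> converges in $L^1(\mu)$ to what the diffusion chain rule
  $L(T(W)) = T'(W)\,LW + T''(W)\,\Gamma(W)$ prescribes. In the case $L = \Delta - \nabla V \cdot \nabla$
  this covers the $C^2$ functions \<open>W\<close> tending to infinity at infinity, where $T(W)$ is constant
  outside a compact set and \<open>LW\<close> is the pointwise expression.
\<close>

definition smooth_enough :: "'a measure \<Rightarrow> ('a \<Rightarrow> real) set \<Rightarrow> (('a \<Rightarrow> real) \<Rightarrow> 'a \<Rightarrow> real) \<Rightarrow>
    ('a \<Rightarrow> real) \<Rightarrow> ('a \<Rightarrow> real) \<Rightarrow> bool"
  where "smooth_enough \<mu> \<A> L W LW \<longleftrightarrow>
    W \<in> borel_measurable \<mu> \<and> LW \<in> borel_measurable \<mu> \<and>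
    (\<exists>\<Gamma>W \<in> borel_measurable \<mu>. (AE x in \<mu>. 0 \<le> \<Gamma>W x) \<and>
      (\<forall>T T' T''. C2_truncation T T' T'' \<longrightarrow>
        (\<exists>h :: nat \<Rightarrow> 'a \<Rightarrow> real.
          (\<forall>k. h k \<in> \<A>) \<and>
          (\<exists>K. \<forall>k x. \<bar>h k x\<bar> \<le> K) \<and>
          (AE x in \<mu>. (\<lambda>k. h k x) \<longlonglongrightarrow> T (W x)) \<and>
          (\<lambda>k. \<integral>\<^sup>+ x. ennreal \<bar>L (h k) x - (T' (W x) * LW x + T'' (W x) * \<Gamma>W x)\<bar> \<partial>\<mu>)
            \<longlonglongrightarrow> 0)))"

definition Var :: "'a measure \<Rightarrow> ('a \<Rightarrow> real) \<Rightarrow> real"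
  where "Var \<mu> f = (\<integral>x. (f x)\<^sup>2 \<partial>\<mu>) - (\<integral>x. f x \<partial>\<mu>)\<^sup>2"

definition essinf :: "'a measure \<Rightarrow> ('a \<Rightarrow> ereal) \<Rightarrow> ereal"
  where "essinf \<mu> f = - esssup \<mu> (\<lambda>x. - f x)"

definition Osc :: "'a measure \<Rightarrow> ('a \<Rightarrow> real) \<Rightarrow> real"
  where "Osc \<mu> f = real_of_ereal (esssup \<mu> (\<lambda>x. ereal (f x)) - essinf \<mu> (\<lambda>x. ereal (f x)))"

definition quantile_inv :: "(real \<Rightarrow> real) \<Rightarrow> real \<Rightarrow> real"
  where "quantile_inv F s = Inf {u. F u > s}"

end

theory Submission
  imports Defs
begin

text \<open>
  For a positive nondecreasing $C^1$ function \<open>w\<close>, integration by parts and the Young inequality give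
  formally
  \[ \int f^2\,\frac{-LW}{w(W)}\,d\mu = \int \Big(\frac{2f}{w(W)}\Gamma(f,W)
     - \frac{f^2 w'(W)}{w(W)^2}\Gamma(W)\Big)d\mu \le \int \frac{\Gamma(f)}{w'(W)}\,d\mu, \]
  and the Lyapunov condition bounds the left-hand side from below by
  $\int f^2 \phi(W)/w(W)\,d\mu - (b/w(1)) \int_{|x|\le R} f^2\,d\mu$. The choice $w=\phi$ leads to
  the weighted inequality and $w(t)=t$ to the converse one, after applying the local Poincare inequality
  to $f-c$ with \<open>c\<close> the average of \<open>f\<close> over the ball. The weak inequality follows by splitting
  $\int (f-c)^2\,d\mu$ according to whether $\phi(W)/W$ is below \<open>u\<close>, and letting \<open>u\<close> increase to the
  quantile.

  The formal computation is justified by the nice functions $h_k$ that approximate a truncation of \<open>W\<close>: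
  they are bounded and $L h_k$ converges in $L^1$, so that
  $\int\Gamma(h_k-h_l)\,d\mu = -\int (h_k-h_l)\,L(h_k-h_l)\,d\mu$ tends to 0, and $\Gamma(h_k)$ and
  $\Gamma(f,h_k)$ converge in $L^1$ as well.
\<close>

section \<open>Integrals and polynomial approximation\<close>

text \<open>Three obstacles shape the details. The chain rule is available for smooth functions
  only, whereas \<open>w\<close> is just C^1. As nice functions are bounded, it suffices to
  approximate a C^1 function and its derivative by a polynomial, uniformly on a bounded interval.
  Next, truncating \<open>W\<close> replaces \<open>LW\<close> by an expression in \<open>T'\<close>
  and \<open>T''\<close> to which the Lyapunov condition does not apply. So 1/w is first multiplied
  by a cutoff that vanishes at large values, and \<open>T\<close> is the identity wherever this
  product is nonzero. The cutoff is removed at the end by monotone convergence. Finally, the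
  derivative of \<phi> may vanish, and then the weighted energy needs care: if it is finite as an
  extended integral, the carre du champ of \<open>f\<close> vanishes almost everywhere on that set,
  which makes the real convention x/0 = 0 harmless. The constants come from w(1): it is \<phi>(1) in
  the weighted inequality and 1 in the converse one. The constant of the weak inequality is that of
  the converse one, 1 + b\<kappa>.\<close>

lemma integrable_bounded_mult:
  fixes u g :: "'a \<Rightarrow> real"
  assumes "integrable M u" "g \<in> borel_measurable M" "AE x in M. \<bar>g x\<bar> \<le> K"
  shows "integrable M (\<lambda>x. g x * u x)"
proof (rule Bochner_Integration.integrable_bound)
  show "integrable M (\<lambda>x. K * u x)" using assms(1) by simp
  show "(\<lambda>x. g x * u x) \<in> borel_measurable M" using assms(1,2) by simp
  show "AE x in M. norm (g x * u x) \<le> norm (K * u x)"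
    using assms(3) by eventually_elim (auto simp: abs_mult intro!: mult_right_mono)
qed

text \<open>The increments have summable L^1 norms, so the sum of their absolute values is
  integrable and finite almost everywhere. It controls the telescoping series and serves as a
  majorant, so that dominated convergence stays available after multiplication by bounded varying
  weights.\<close>

lemma fast_L1_Cauchy_dominated:
  fixes G :: "nat \<Rightarrow> 'a \<Rightarrow> real"
  assumes int: "\<And>k. integrable M (G k)"
    and fast: "\<And>k. (\<integral>x. \<bar>G (Suc k) x - G k x\<bar> \<partial>M) \<le> C * (1/2) ^ k"
  obtains H w where "integrable M H" "integrable M w"
    "AE x in M. (\<lambda>k. G k x) \<longlonglongrightarrow> H x" "\<And>k. AE x in M. \<bar>G k x\<bar> \<le> w x"
proof -
  note [measurable] = borel_measurable_integrable[OF int]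
  define d where "d k = (\<lambda>x. \<bar>G (Suc k) x - G k x\<bar>)" for k
  have [measurable]: "d k \<in> borel_measurable M" for k unfolding d_def by measurable
  have d_int: "integrable M (d k)" for k
    unfolding d_def using int by auto
  have d_nn: "0 \<le> d k x" for k x by (simp add: d_def)
  have C: "0 \<le> C"
    using order_trans[OF _ fast[of 0]] by simp
  have geo: "summable (\<lambda>k. C * (1/2::real) ^ k)"
    by (intro summable_mult summable_geometric) simp
  have I_le: "integral\<^sup>L M (d k) \<le> C * (1/2) ^ k" for k
    using fast[of k] by (simp add: d_def)
  have I_nn: "0 \<le> integral\<^sup>L M (d k)" for k
    by (simp add: d_nn)
  have I_sum: "summable (\<lambda>k. integral\<^sup>L M (d k))"
    by (rule summable_comparison_test'[OF geo, of 0]) (use I_le I_nn in auto)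
  have "(\<integral>\<^sup>+x. (\<Sum>k. ennreal (d k x)) \<partial>M) = (\<Sum>k. \<integral>\<^sup>+x. ennreal (d k x) \<partial>M)"
    by (intro nn_integral_suminf) auto
  also have "\<dots> = (\<Sum>k. ennreal (integral\<^sup>L M (d k)))"
    by (intro arg_cong[where f=suminf] ext nn_integral_eq_integral d_int) (auto simp: d_nn)
  also have "\<dots> \<noteq> \<infinity>"
    using I_sum I_nn by (simp add: ennreal_suminf_neq_top)
  finally have "AE x in M. (\<Sum>k. ennreal (d k x)) \<noteq> \<infinity>"
    by (intro nn_integral_PInf_AE) auto
  then have summ: "AE x in M. summable (\<lambda>k. d k x)"
    by eventually_elim (rule summable_suminf_not_top, auto simp: d_nn)
  have w_int: "integrable M (\<lambda>x. \<bar>G 0 x\<bar> + (\<Sum>k. d k x))"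
    using int summ d_nn I_sum d_int
    by (intro Bochner_Integration.integrable_add integrable_suminf) auto
  have tele: "(\<Sum>i<k. G (Suc i) x - G i x) = G k x - G 0 x" for k x
    by (rule sum_lessThan_telescope)
  have bound: "AE x in M. \<bar>G k x\<bar> \<le> \<bar>G 0 x\<bar> + (\<Sum>k. d k x)" for k
    using summ
  proof eventually_elim
    case (elim x)
    have "\<bar>G k x - G 0 x\<bar> \<le> (\<Sum>i<k. d i x)"
      unfolding tele[symmetric] d_def by (rule sum_abs)
    also have "\<dots> \<le> (\<Sum>i. d i x)"
      by (rule sum_le_suminf[OF elim]) (auto simp: d_nn)
    finally show ?case by linarith
  qed
  have lim: "AE x in M. (\<lambda>k. G k x) \<longlonglongrightarrow> G 0 x + (\<Sum>i. G (Suc i) x - G i x)"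
    using summ
  proof eventually_elim
    case (elim x)
    have "summable (\<lambda>i. G (Suc i) x - G i x)"
      by (rule summable_rabs_cancel) (use elim in \<open>simp add: d_def\<close>)
    from tendsto_add[OF tendsto_const summable_LIMSEQ[OF this], of "G 0 x"]
    show ?case by (simp add: tele)
  qed
  have "integrable M (\<lambda>x. G 0 x + (\<Sum>i. G (Suc i) x - G i x))"
    using summ I_sum int
    by (intro Bochner_Integration.integrable_add integrable_suminf Bochner_Integration.integrable_diff) (auto simp: d_def)
  with w_int lim bound show ?thesis by (intro that)
qed

section \<open>Polynomials as smooth functions and as C^1 approximants\<close>

lemma smooth_real_poly: "smooth_real (poly p)"
proof -
  have "(deriv ^^ k) (poly p) = poly ((pderiv ^^ k) p)" for k
  proof (induction k)
    case (Suc k)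
    have "deriv (poly q) = poly (pderiv q)" for q :: "real poly"
      by (rule ext, rule DERIV_imp_deriv) (rule poly_DERIV)
    with Suc show ?case by simp
  qed simp
  then show ?thesis
    unfolding smooth_real_def using real_differentiable_def poly_DERIV by metis
qed

lemma deriv_poly: "deriv (poly p) t = poly (pderiv p) (t::real)"
  by (rule DERIV_imp_deriv) (rule poly_DERIV)

lemma continuous_bounded_Icc:
  fixes \<psi> :: "real \<Rightarrow> real"
  assumes "continuous_on UNIV \<psi>"
  obtains B where "\<And>t. \<bar>t\<bar> \<le> K \<Longrightarrow> \<bar>\<psi> t\<bar> \<le> B"
proof -
  have "bounded (\<psi> ` {-K..K})"
    by (intro compact_imp_bounded compact_continuous_image continuous_on_subset[OF assms] compact_Icc) simp
  then obtain B where "\<forall>y\<in>\<psi> ` {-K..K}. norm y \<le> B" unfolding bounded_iff by blast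
  then have "\<bar>\<psi> t\<bar> \<le> B" if "\<bar>t\<bar> \<le> K" for t using that by (simp add: abs_le_iff)
  then show ?thesis by (rule that)
qed

text \<open>Weierstrass is applied to the derivative, and the approximant is then integrated from
  the exact value at 0. The mean value inequality turns the error \<open>e\<close> into
  \<open>e * K\<close>.\<close>

lemma C1_approx_poly:
  fixes \<psi> \<psi>' :: "real \<Rightarrow> real"
  assumes deriv: "\<And>t. (\<psi> has_real_derivative \<psi>' t) (at t)" and cont: "continuous_on UNIV \<psi>'"
    and "e > 0" "K > 0"
  obtains p where "\<And>t. \<bar>t\<bar> \<le> K \<Longrightarrow> \<bar>poly (pderiv p) t - \<psi>' t\<bar> \<le> e"
    "\<And>t. \<bar>t\<bar> \<le> K \<Longrightarrow> \<bar>poly p t - \<psi> t\<bar> \<le> e * K"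
proof -
  obtain g where g: "real_polynomial_function g" "\<And>t. t \<in> {-K..K} \<Longrightarrow> \<bar>\<psi>' t - g t\<bar> < e"
    using Stone_Weierstrass_real_polynomial_function[of "{-K..K}" \<psi>' e] assms
    by (metis compact_Icc continuous_on_subset subset_UNIV)
  obtain a n where a: "g = (\<lambda>x. \<Sum>i\<le>n. a i * x^i)"
    using g(1) by (auto simp: real_polynomial_function_iff_sum)
  \<comment> \<open>\<open>q\<close> is the antiderivative of \<open>g\<close> that vanishes at
    0.\<close>
  define q where "q = (\<Sum>i\<le>n. monom (a i / real (Suc i)) (Suc i))"
  define p where "p = [:\<psi> 0:] + q"
  have "pderiv q = (\<Sum>i\<le>n. monom (a i) i)"
    unfolding q_def by (induction n) (simp_all add: pderiv_monom pderiv_add del: of_nat_Suc)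
  then have dp: "poly (pderiv p) t = g t" for t
    by (simp add: p_def a pderiv_add pderiv_pCons poly_sum poly_monom)
  have p0: "poly p 0 = \<psi> 0"
    by (simp add: p_def q_def poly_sum poly_monom)
  have 1: "\<bar>poly (pderiv p) t - \<psi>' t\<bar> \<le> e" if "\<bar>t\<bar> \<le> K" for t
    using g(2)[of t] that by (auto simp: dp abs_le_iff abs_less_iff)
  have 2: "\<bar>poly p t - \<psi> t\<bar> \<le> e * K" if t: "\<bar>t\<bar> \<le> K" for t
  proof -
    have "norm ((poly p t - \<psi> t) - (poly p 0 - \<psi> 0)) \<le> e * norm (t - 0)"
    proof (rule field_differentiable_bound[where S="{-K..K}" and f'="\<lambda>t. poly (pderiv p) t - \<psi>' t"])
      show "((\<lambda>t. poly p t - \<psi> t) has_field_derivative poly (pderiv p) z - \<psi>' z) (at z within {-K..K})" for z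
        by (intro DERIV_diff DERIV_subset[OF poly_DERIV] DERIV_subset[OF deriv]) auto
    qed (use 1 t \<open>K > 0\<close> in auto)
    also have "\<dots> \<le> e * K" using t \<open>e > 0\<close> by (intro mult_left_mono) auto
    finally show ?thesis by (simp add: p0)
  qed
  show ?thesis using 1 2 by (rule that)
qed

section \<open>Calculus of the carre du champ\<close>

context symmetric_diffusion
begin

abbreviation \<Gamma> :: "(real ^ 'n \<Rightarrow> real) \<Rightarrow> (real ^ 'n \<Rightarrow> real) \<Rightarrow> real ^ 'n \<Rightarrow> real"
  where "\<Gamma> \<equiv> carre_du_champ L"

lemma alg_dom: "f \<in> \<A> \<Longrightarrow> f \<in> D"
  using alg_subset by blast

lemma alg_scale: "f \<in> \<A> \<Longrightarrow> (\<lambda>x. c * f x) \<in> \<A>"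
  by (rule alg_mult[OF alg_const])

lemma alg_diff: "f \<in> \<A> \<Longrightarrow> g \<in> \<A> \<Longrightarrow> (\<lambda>x. f x - g x) \<in> \<A>"
  using alg_add[OF _ alg_scale[of g "-1"], of f] by simp

lemma alg_measurable: "f \<in> \<A> \<Longrightarrow> f \<in> borel_measurable \<mu>"
  by (simp add: alg_dom dom_measurable)

lemma L_integrable: "f \<in> \<A> \<Longrightarrow> integrable \<mu> (L f)"
  by (rule square_integrable_imp_integrable[OF L_measurable L_L2]) (auto intro: alg_dom)

lemma alg_mult_integrable:
  assumes "f \<in> \<A>" "integrable \<mu> u" shows "integrable \<mu> (\<lambda>x. f x * u x)"
proof -
  obtain K where "\<And>x. \<bar>f x\<bar> \<le> K" using alg_bounded[OF assms(1)] by blast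
  then show ?thesis
    by (intro integrable_bounded_mult[OF assms(2) alg_measurable[OF assms(1)], of K]) simp
qed

lemma alg_integrable: "f \<in> \<A> \<Longrightarrow> integrable \<mu> f"
  using alg_mult_integrable[of f "\<lambda>_. 1"] by simp

lemma gamma_integrable:
  assumes "f \<in> \<A>" "g \<in> \<A>" shows "integrable \<mu> (\<Gamma> f g)"
  unfolding carre_du_champ_def[abs_def]
  by (intro integrable_divide_zero Bochner_Integration.integrable_diff alg_mult_integrable L_integrable alg_mult assms)

lemma gamma_measurable: "f \<in> \<A> \<Longrightarrow> g \<in> \<A> \<Longrightarrow> \<Gamma> f g \<in> borel_measurable \<mu>"
  by (rule borel_measurable_integrable[OF gamma_integrable])

lemma gamma_commute: "\<Gamma> f g x = \<Gamma> g f x"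
  by (simp add: carre_du_champ_def mult.commute)

section \<open>Bilinearity and positivity of the carre du champ\<close>

lemma gamma_add_left:
  assumes "f \<in> \<A>" "g \<in> \<A>" "h \<in> \<A>"
  shows "AE x in \<mu>. \<Gamma> (\<lambda>y. f y + g y) h x = \<Gamma> f h x + \<Gamma> g h x"
  using L_add[of "\<lambda>x. f x * h x" "\<lambda>x. g x * h x"] L_add[of f g]
  by (simp add: alg_dom alg_mult assms) (auto simp: carre_du_champ_def field_simps)

lemma gamma_scale_left:
  assumes "f \<in> \<A>" "h \<in> \<A>"
  shows "AE x in \<mu>. \<Gamma> (\<lambda>y. c * f y) h x = c * \<Gamma> f h x"
  using L_scale[of "\<lambda>x. f x * h x" c] L_scale[of f c]
  by (simp add: alg_dom alg_mult assms) (auto simp: carre_du_champ_def field_simps)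

lemma gamma_quadratic:
  assumes "f \<in> \<A>" "g \<in> \<A>"
  shows "AE x in \<mu>. \<Gamma> (\<lambda>y. f y + q * g y) (\<lambda>y. f y + q * g y) x
    = \<Gamma> f f x + 2 * q * \<Gamma> f g x + q\<^sup>2 * \<Gamma> g g x"
proof -
  define h where "h = (\<lambda>y. q * g y)"
  have h: "h \<in> \<A>" and s: "(\<lambda>y. f y + h y) \<in> \<A>"
    using assms by (auto simp: h_def intro: alg_add alg_scale)
  have "AE x in \<mu>. \<Gamma> (\<lambda>y. f y + h y) (\<lambda>y. f y + h y) x
      = \<Gamma> f f x + 2 * q * \<Gamma> f g x + q\<^sup>2 * \<Gamma> g g x"
    using gamma_add_left[OF assms(1) h s] gamma_add_left[OF assms(1) h assms(1)]
      gamma_add_left[OF assms(1) h h]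
      gamma_scale_left[OF assms(2) assms(1), of q] gamma_scale_left[OF assms(2) h, of q]
      gamma_scale_left[OF assms(2) assms(2), of q]
    unfolding h_def[symmetric]
    by eventually_elim
      (auto simp: gamma_commute[of f "\<lambda>y. f y + h y"] gamma_commute[of h "\<lambda>y. f y + h y"]
        gamma_commute[of f h] gamma_commute[of g h] gamma_commute[of g f] algebra_simps power2_eq_square)
  then show ?thesis by (simp add: h_def)
qed

text \<open>Cauchy-Schwarz in the form of a nonnegative quadratic. The exceptional null set depends
  on \<open>q\<close>, since linearity of \<open>L\<close> holds only almost everywhere for each
  given pair of functions.\<close>

lemma gamma_quadratic_nonneg:
  assumes "f \<in> \<A>" "g \<in> \<A>"
  shows "AE x in \<mu>. 0 \<le> \<Gamma> f f x + 2 * q * \<Gamma> f g x + q\<^sup>2 * \<Gamma> g g x"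
  using gamma_quadratic[OF assms, of q] gamma_nonneg[OF alg_add[OF assms(1) alg_scale[OF assms(2)]], of q]
  by eventually_elim simp

text \<open>Polarization. It reduces the L^1 distance of two carre du champ to a mixed term in which
  one factor is the small difference.\<close>

lemma gamma_diff_square:
  assumes "f \<in> \<A>" "g \<in> \<A>"
  shows "AE x in \<mu>. \<Gamma> f f x - \<Gamma> g g x = \<Gamma> (\<lambda>y. f y + g y) (\<lambda>y. f y - g y) x"
proof -
  have s: "(\<lambda>y. f y + g y) \<in> \<A>" and d: "(\<lambda>y. f y - g y) \<in> \<A>"
    using assms by (auto intro: alg_add alg_diff)
  have *: "AE x in \<mu>. \<Gamma> (\<lambda>y. f y - g y) h x = \<Gamma> f h x - \<Gamma> g h x" if "h \<in> \<A>" for h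
    using gamma_add_left[OF assms(1) alg_scale[OF assms(2), of "-1"] that]
      gamma_scale_left[OF assms(2) that, of "-1"]
    by eventually_elim simp
  show ?thesis
    using *[OF s] gamma_add_left[OF assms assms(1)] gamma_add_left[OF assms assms(2)]
    by eventually_elim
      (auto simp: gamma_commute[of _ "\<lambda>y. f y - g y"] gamma_commute[of f "\<lambda>y. f y + g y"]
        gamma_commute[of g "\<lambda>y. f y + g y"] gamma_commute[of g f])
qed

text \<open>The derivation property at 1 = 1 * 1 gives \<Gamma>(1,1) = 2 \<Gamma>(1,1), hence 0,
  while by definition \<Gamma>(1,1) = - L1 / 2.\<close>

lemma L_one: "AE x in \<mu>. L (\<lambda>y. 1) x = 0"
  using gamma_derivation[OF alg_const alg_const alg_const, of 1 1 1]
  by eventually_elim (simp add: carre_du_champ_def)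

text \<open>Invariance of the measure: symmetry tested against the constant 1, which
  \<open>L\<close> annihilates.\<close>

lemma integral_L_zero:
  assumes "f \<in> \<A>" shows "(\<integral>x. L f x \<partial>\<mu>) = 0"
proof -
  have "(\<integral>x. L f x \<partial>\<mu>) = (\<integral>x. f x * L (\<lambda>y. 1) x \<partial>\<mu>)"
    using L_symmetric[OF alg_dom[OF alg_const] alg_dom[OF assms], of 1] by simp
  also have "\<dots> = (\<integral>x. 0 \<partial>\<mu>)"
    by (rule integral_cong_AE)
      (use L_one alg_measurable[OF assms] L_measurable[OF alg_dom[OF alg_const]] in auto)
  finally show ?thesis by simp
qed

lemma integral_gamma:
  assumes "f \<in> \<A>" "g \<in> \<A>" shows "(\<integral>x. \<Gamma> f g x \<partial>\<mu>) = - (\<integral>x. f x * L g x \<partial>\<mu>)"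
proof -
  have "(\<integral>x. \<Gamma> f g x \<partial>\<mu>) = ((\<integral>x. L (\<lambda>y. f y * g y) x \<partial>\<mu>) - (\<integral>x. f x * L g x \<partial>\<mu>) - (\<integral>x. g x * L f x \<partial>\<mu>)) / 2"
    unfolding carre_du_champ_def
    by (simp add: Bochner_Integration.integral_diff alg_mult_integrable L_integrable alg_mult assms)
  then show ?thesis
    using L_symmetric[OF alg_dom[OF assms(1)] alg_dom[OF assms(2)]]
    by (simp add: integral_L_zero alg_mult assms)
qed

lemma integral_gamma_nonneg: "f \<in> \<A> \<Longrightarrow> 0 \<le> (\<integral>x. \<Gamma> f f x \<partial>\<mu>)"
  by (intro integral_nonneg_AE gamma_nonneg)

text \<open>The energy of a uniformly bounded function is controlled by the L^1 norm of its image
  under \<open>L\<close>. This is why convergence of \<open>L (h k)\<close> in L^1 alone is enough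
  later.\<close>

lemma integral_gamma_le:
  assumes "f \<in> \<A>" "\<And>x. \<bar>f x\<bar> \<le> K"
  shows "(\<integral>x. \<Gamma> f f x \<partial>\<mu>) \<le> K * (\<integral>x. \<bar>L f x\<bar> \<partial>\<mu>)"
proof -
  have "(\<integral>x. \<Gamma> f f x \<partial>\<mu>) = (\<integral>x. - (f x * L f x) \<partial>\<mu>)"
    by (simp add: integral_gamma assms)
  also have "\<dots> \<le> (\<integral>x. K * \<bar>L f x\<bar> \<partial>\<mu>)"
  proof (rule integral_mono)
    show "integrable \<mu> (\<lambda>x. - (f x * L f x))"
      by (simp add: alg_mult_integrable L_integrable assms)
    show "integrable \<mu> (\<lambda>x. K * \<bar>L f x\<bar>)"
      by (simp add: L_integrable assms)
    fix x
    have "- (f x * L f x) \<le> \<bar>f x\<bar> * \<bar>L f x\<bar>" by (metis abs_ge_minus_self abs_mult)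
    also have "\<dots> \<le> K * \<bar>L f x\<bar>" by (intro mult_right_mono assms) simp
    finally show "- (f x * L f x) \<le> K * \<bar>L f x\<bar>" .
  qed
  finally show ?thesis by simp
qed

text \<open>The two values q = 1/t and q = -1/t in the quadratic bound both signs of \<Gamma>(f,g).
  The parameter \<open>t\<close> replaces the square roots of Cauchy-Schwarz and will be 2^-k, to
  balance a bounded energy against one of order 4^-k.\<close>

lemma integral_abs_gamma_le:
  assumes "f \<in> \<A>" "g \<in> \<A>" "t > 0"
  shows "(\<integral>x. \<bar>\<Gamma> f g x\<bar> \<partial>\<mu>) \<le> ((\<integral>x. \<Gamma> f f x \<partial>\<mu>) * t + (\<integral>x. \<Gamma> g g x \<partial>\<mu>) / t) / 2"
proof -
  have "(\<integral>x. \<bar>\<Gamma> f g x\<bar> \<partial>\<mu>) \<le> (\<integral>x. (\<Gamma> f f x * t + \<Gamma> g g x / t) / 2 \<partial>\<mu>)"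
  proof (rule integral_mono_AE)
    show "AE x in \<mu>. \<bar>\<Gamma> f g x\<bar> \<le> (\<Gamma> f f x * t + \<Gamma> g g x / t) / 2"
      using gamma_quadratic_nonneg[OF assms(1,2), of "1/t"] gamma_quadratic_nonneg[OF assms(1,2), of "-1/t"]
    proof eventually_elim
      case (elim x)
      have "t * (\<Gamma> f f x + 2 * q * \<Gamma> f g x + q\<^sup>2 * \<Gamma> g g x)
          = \<Gamma> f f x * t + 2 * (q * t) * \<Gamma> f g x + (q * t)\<^sup>2 * \<Gamma> g g x / t" for q
        using \<open>t > 0\<close> by (simp add: field_simps power2_eq_square)
      from this[of "1/t"] this[of "-1/t"] mult_nonneg_nonneg[OF less_imp_le[OF \<open>t > 0\<close>] elim(1)]
        mult_nonneg_nonneg[OF less_imp_le[OF \<open>t > 0\<close>] elim(2)]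
      show ?case using \<open>t > 0\<close> by (simp add: abs_le_iff)
    qed
  qed (intro integrable_divide_zero integrable_abs Bochner_Integration.integrable_add
      integrable_mult_left gamma_integrable assms)+
  also have "\<dots> = ((\<integral>x. \<Gamma> f f x \<partial>\<mu>) * t + (\<integral>x. \<Gamma> g g x \<partial>\<mu>) / t) / 2"
    by (simp add: gamma_integrable assms)
  finally show ?thesis .
qed

text \<open>The chain rule for the polynomial X - c, whose derivative is 1.\<close>

lemma gamma_shift:
  assumes "f \<in> \<A>" shows "AE x in \<mu>. \<Gamma> (\<lambda>y. f y - c) (\<lambda>y. f y - c) x = \<Gamma> f f x"
proof -
  have "(\<lambda>y. f y - c) = (\<lambda>y. poly [:- c, 1:] (f y))" by simp
  then show ?thesis
    using gamma_chain[OF assms assms smooth_real_poly smooth_real_poly, of "[:- c, 1:]" "[:- c, 1:]"]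
    by (simp add: deriv_poly pderiv_pCons)
qed

text \<open>Integration by parts for the pair f^2 p(g) and g: the product stays in the algebra
  because \<open>p\<close> is a polynomial, and the derivation property with the chain rule expands
  its carre du champ.\<close>

lemma weighted_parts_poly:
  assumes f: "f \<in> \<A>" and g: "g \<in> \<A>"
  shows "- (\<integral>x. (f x)\<^sup>2 * poly p (g x) * L g x \<partial>\<mu>)
    = (\<integral>x. 2 * f x * poly p (g x) * \<Gamma> f g x + (f x)\<^sup>2 * poly (pderiv p) (g x) * \<Gamma> g g x \<partial>\<mu>)"
proof -
  define P where "P = (\<lambda>x. poly p (g x))"
  define P' where "P' = (\<lambda>x. poly (pderiv p) (g x))"
  have P: "P \<in> \<A>" and P': "P' \<in> \<A>"
    unfolding P_def P'_def by (intro alg_smooth[OF g smooth_real_poly])+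
  have ff: "(\<lambda>x. f x * f x) \<in> \<A>" by (intro alg_mult f)
  have ffP: "(\<lambda>x. (f x * f x) * P x) \<in> \<A>" by (intro alg_mult f P)
  \<comment> \<open>The chain rule composes both arguments, so \<open>g\<close> itself is written as
    the polynomial \<open>[:0,1:]\<close> of \<open>g\<close>.\<close>
  have "AE x in \<mu>. \<Gamma> P g x = P' x * \<Gamma> g g x"
    using gamma_chain[OF g g smooth_real_poly smooth_real_poly, of p "[:0,1:]"]
    by (simp add: deriv_poly pderiv_pCons P_def P'_def)
  then have AE: "AE x in \<mu>. \<Gamma> (\<lambda>y. (f y * f y) * P y) g x
      = 2 * f x * P x * \<Gamma> f g x + (f x)\<^sup>2 * P' x * \<Gamma> g g x"
    using gamma_derivation[OF ff P g] gamma_derivation[OF f f g]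
    by eventually_elim (auto simp: power2_eq_square algebra_simps)
  note [measurable] = alg_measurable[OF f] alg_measurable[OF P] alg_measurable[OF P']
    gamma_measurable[OF f g] gamma_measurable[OF g g] gamma_measurable[OF ffP g]
  have "- (\<integral>x. (f x)\<^sup>2 * P x * L g x \<partial>\<mu>) = (\<integral>x. \<Gamma> (\<lambda>y. (f y * f y) * P y) g x \<partial>\<mu>)"
    by (simp add: integral_gamma[OF ffP g] power2_eq_square)
  also have "\<dots> = (\<integral>x. 2 * f x * P x * \<Gamma> f g x + (f x)\<^sup>2 * P' x * \<Gamma> g g x \<partial>\<mu>)"
    by (rule integral_cong_AE) (use AE in auto)
  finally show ?thesis by (simp add: P_def P'_def)
qed

text \<open>Only the weights vary in the approximation. They and their derivatives converge
  uniformly on the range of \<open>g\<close>, so fixed multiples of integrable functions dominate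
  all the integrands.\<close>

lemma weighted_parts_C1:
  assumes f: "f \<in> \<A>" and g: "g \<in> \<A>"
    and deriv: "\<And>t. (\<psi> has_real_derivative \<psi>' t) (at t)" and cont: "continuous_on UNIV \<psi>'"
  shows "- (\<integral>x. (f x)\<^sup>2 * \<psi> (g x) * L g x \<partial>\<mu>)
    = (\<integral>x. 2 * f x * \<psi> (g x) * \<Gamma> f g x + (f x)\<^sup>2 * \<psi>' (g x) * \<Gamma> g g x \<partial>\<mu>)"
proof -
  obtain K0 where K0: "\<And>x. \<bar>g x\<bar> \<le> K0" using alg_bounded[OF g] by blast
  \<comment> \<open>The bound \<open>K0\<close> could be 0, while the approximation needs an
    interval of positive radius.\<close>
  define K where "K = max K0 1"
  have K: "K > 0" "\<And>x. \<bar>g x\<bar> \<le> K" using K0 by (auto simp: K_def le_max_iff_disj)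
  have cont\<psi>: "continuous_on UNIV \<psi>"
    using deriv by (intro DERIV_continuous_on[where D=\<psi>']) (auto intro: has_field_derivative_at_within)
  have "\<forall>j. \<exists>p. (\<forall>t. \<bar>t\<bar> \<le> K \<longrightarrow> \<bar>poly (pderiv p) t - \<psi>' t\<bar> \<le> 1 / real (Suc j)) \<and>
      (\<forall>t. \<bar>t\<bar> \<le> K \<longrightarrow> \<bar>poly p t - \<psi> t\<bar> \<le> 1 / real (Suc j) * K)"
  proof
    fix j
    show "\<exists>p. (\<forall>t. \<bar>t\<bar> \<le> K \<longrightarrow> \<bar>poly (pderiv p) t - \<psi>' t\<bar> \<le> 1 / real (Suc j)) \<and>
      (\<forall>t. \<bar>t\<bar> \<le> K \<longrightarrow> \<bar>poly p t - \<psi> t\<bar> \<le> 1 / real (Suc j) * K)"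
      by (rule C1_approx_poly[OF deriv cont _ K(1), of "1 / real (Suc j)"]) auto
  qed
  then obtain p where p: "\<And>j t. \<bar>t\<bar> \<le> K \<Longrightarrow> \<bar>poly (pderiv (p j)) t - \<psi>' t\<bar> \<le> 1 / real (Suc j)"
      "\<And>j t. \<bar>t\<bar> \<le> K \<Longrightarrow> \<bar>poly (p j) t - \<psi> t\<bar> \<le> 1 / real (Suc j) * K"
    by metis
  have lim0: "(\<lambda>j. 1 / real (Suc j) * c) \<longlonglongrightarrow> 0" for c
    using tendsto_mult_left_zero[OF LIMSEQ_inverse_real_of_nat, of c] by (simp add: inverse_eq_divide)
  have lim1: "(\<lambda>j. poly (p j) (g x)) \<longlonglongrightarrow> \<psi> (g x)" for x
    by (rule LIM_zero_cancel, rule Lim_null_comparison[OF _ lim0[of K]])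
      (use p(2)[OF K(2)] in \<open>auto intro!: always_eventually\<close>)
  have lim2: "(\<lambda>j. poly (pderiv (p j)) (g x)) \<longlonglongrightarrow> \<psi>' (g x)" for x
    by (rule LIM_zero_cancel, rule Lim_null_comparison[OF _ lim0[of 1]])
      (use p(1)[OF K(2)] in \<open>auto intro!: always_eventually\<close>)
  obtain B where B: "\<And>t. \<bar>t\<bar> \<le> K \<Longrightarrow> \<bar>\<psi> t\<bar> \<le> B"
    using continuous_bounded_Icc[OF cont\<psi>] by blast
  obtain B' where B': "\<And>t. \<bar>t\<bar> \<le> K \<Longrightarrow> \<bar>\<psi>' t\<bar> \<le> B'"
    using continuous_bounded_Icc[OF cont] by blast
  have b1: "\<bar>poly (p j) (g x)\<bar> \<le> B + K" for j x
  proof -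
    have "1 / real (Suc j) * K \<le> 1 * K" using K(1) by (intro mult_right_mono) auto
    then show ?thesis using p(2)[OF K(2), of j x] B[OF K(2), of x] by linarith
  qed
  have b2: "\<bar>poly (pderiv (p j)) (g x)\<bar> \<le> B' + 1" for j x
  proof -
    have "1 / real (Suc j) \<le> 1" by auto
    then show ?thesis using p(1)[OF K(2), of j x] B'[OF K(2), of x] by linarith
  qed
  note [measurable] = alg_measurable[OF f] alg_measurable[OF g]
    gamma_measurable[OF f g] gamma_measurable[OF g g] borel_measurable_integrable[OF L_integrable[OF g]]
  have [measurable]: "(\<lambda>x. \<psi> (g x)) \<in> borel_measurable \<mu>" "(\<lambda>x. \<psi>' (g x)) \<in> borel_measurable \<mu>"
    using cont cont\<psi> by (auto intro: borel_measurable_continuous_on)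
  have [measurable]: "(\<lambda>x. poly q (g x)) \<in> borel_measurable \<mu>" for q
    by (intro borel_measurable_continuous_on[where f="poly q"]) (auto intro: continuous_intros)
  have ff: "(\<lambda>x. (f x)\<^sup>2) \<in> \<A>" using alg_mult[OF f f] by (simp add: power2_eq_square)
  have f2: "(\<lambda>x. 2 * f x) \<in> \<A>" using alg_scale[OF f] .
  have "(\<lambda>j. - (\<integral>x. (f x)\<^sup>2 * poly (p j) (g x) * L g x \<partial>\<mu>)) \<longlonglongrightarrow> - (\<integral>x. (f x)\<^sup>2 * \<psi> (g x) * L g x \<partial>\<mu>)"
  proof (intro tendsto_minus integral_dominated_convergence)
    show "integrable \<mu> (\<lambda>x. (B + K) * \<bar>(f x)\<^sup>2 * L g x\<bar>)"
      by (intro integrable_mult_right integrable_abs alg_mult_integrable ff L_integrable g)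
    fix j show "AE x in \<mu>. norm ((f x)\<^sup>2 * poly (p j) (g x) * L g x) \<le> (B + K) * \<bar>(f x)\<^sup>2 * L g x\<bar>"
    proof (rule AE_I2)
      fix x
      show "norm ((f x)\<^sup>2 * poly (p j) (g x) * L g x) \<le> (B + K) * \<bar>(f x)\<^sup>2 * L g x\<bar>"
        using mult_right_mono[OF b1[of j x], of "\<bar>(f x)\<^sup>2 * L g x\<bar>"] by (simp add: abs_mult mult_ac)
    qed
  qed (auto intro!: tendsto_intros lim1)
  moreover have "(\<lambda>j. \<integral>x. 2 * f x * poly (p j) (g x) * \<Gamma> f g x + (f x)\<^sup>2 * poly (pderiv (p j)) (g x) * \<Gamma> g g x \<partial>\<mu>)
    \<longlonglongrightarrow> (\<integral>x. 2 * f x * \<psi> (g x) * \<Gamma> f g x + (f x)\<^sup>2 * \<psi>' (g x) * \<Gamma> g g x \<partial>\<mu>)"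
  proof (intro integral_dominated_convergence)
    show "integrable \<mu> (\<lambda>x. (B + K) * \<bar>(2 * f x) * \<Gamma> f g x\<bar> + (B' + 1) * \<bar>(f x)\<^sup>2 * \<Gamma> g g x\<bar>)"
      by (intro Bochner_Integration.integrable_add integrable_mult_right integrable_abs
          alg_mult_integrable ff f2 gamma_integrable f g)
    fix j
    show "AE x in \<mu>. norm (2 * f x * poly (p j) (g x) * \<Gamma> f g x + (f x)\<^sup>2 * poly (pderiv (p j)) (g x) * \<Gamma> g g x)
      \<le> (B + K) * \<bar>(2 * f x) * \<Gamma> f g x\<bar> + (B' + 1) * \<bar>(f x)\<^sup>2 * \<Gamma> g g x\<bar>"
    proof (rule AE_I2)
      fix x
      show "norm (2 * f x * poly (p j) (g x) * \<Gamma> f g x + (f x)\<^sup>2 * poly (pderiv (p j)) (g x) * \<Gamma> g g x)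
        \<le> (B + K) * \<bar>(2 * f x) * \<Gamma> f g x\<bar> + (B' + 1) * \<bar>(f x)\<^sup>2 * \<Gamma> g g x\<bar>"
        unfolding real_norm_def
        by (rule order_trans[OF abs_triangle_ineq add_mono])
          (use mult_right_mono[OF b1[of j x], of "\<bar>(2 * f x) * \<Gamma> f g x\<bar>"]
             mult_right_mono[OF b2[of j x], of "\<bar>(f x)\<^sup>2 * \<Gamma> g g x\<bar>"] in \<open>auto simp: abs_mult ac_simps\<close>)
    qed
  qed (auto intro!: tendsto_intros lim1 lim2)
  ultimately show ?thesis
    unfolding weighted_parts_poly[OF f g] using LIMSEQ_unique by blast
qed

end

section \<open>Truncations and limits of nice functions\<close>

text \<open>Only the kink needs an argument: there the difference quotient is at most |h|^(n+1),
  which tends to 0 because the power is at least 2.\<close>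

lemma has_real_derivative_max_power:
  fixes t :: real
  shows "((\<lambda>t. max 0 (t - a) ^ Suc (Suc n)) has_real_derivative real (Suc (Suc n)) * max 0 (t - a) ^ Suc n) (at t)"
proof -
  consider "t > a" | "t < a" | "t = a" by linarith
  then show ?thesis
  proof cases
    case 1
    have "((\<lambda>t. (t - a) ^ Suc (Suc n)) has_real_derivative real (Suc (Suc n)) * (t - a) ^ Suc n) (at t)"
      by (rule derivative_eq_intros refl)+ simp
    then show ?thesis
      by (rule has_field_derivative_transform_within_open[of _ _ _ "{a<..}", THEN DERIV_cong]) (use 1 in auto)
  next
    case 2
    have "((\<lambda>t. 0) has_real_derivative 0) (at t)" by simp
    then show ?thesis
      by (rule has_field_derivative_transform_within_open[of _ _ _ "{..<a}", THEN DERIV_cong]) (use 2 in auto)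
  next
    case 3
    have "((\<lambda>h. max 0 h ^ Suc (Suc n) / h) \<longlongrightarrow> 0) (at (0::real))"
    proof (rule Lim_null_comparison)
      show "((\<lambda>h. \<bar>h\<bar> ^ Suc n) \<longlongrightarrow> 0) (at (0::real))"
        by (auto intro!: tendsto_eq_intros)
      show "\<forall>\<^sub>F h in at 0. norm (max 0 h ^ Suc (Suc n) / h) \<le> \<bar>h\<bar> ^ Suc n"
        by (intro always_eventually) (auto simp: max_def abs_mult power_abs intro!: mult_nonpos_nonneg)
    qed
    then show ?thesis using 3 by (simp add: DERIV_def)
  qed
qed

text \<open>\<open>T''\<close> is minus the hat function on [m, m+2], whose area is 1, so
  \<open>T'\<close> falls from 1 to 0 across that interval. The last clause ensures that a function
  vanishing from \<open>m\<close> on still vanishes after composition with \<open>T\<close>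
  there.\<close>

lemma truncation_exists:
  fixes m :: real
  obtains T T' T'' where "C2_truncation T T' T''"
    "\<And>t. t \<le> m \<Longrightarrow> T t = t" "\<And>t. t \<le> m \<Longrightarrow> T' t = 1" "\<And>t. t \<le> m \<Longrightarrow> T'' t = 0"
    "\<And>t. t \<ge> m \<Longrightarrow> T t \<ge> m"
proof -
  define P where "P j a t = max 0 (t - a) ^ j" for j :: nat and a t :: real
  have dP: "(P 3 a has_real_derivative 3 * P 2 a t) (at t)"
    "(P 2 a has_real_derivative 2 * P 1 a t) (at t)" for a t
    using has_real_derivative_max_power[where n=1] has_real_derivative_max_power[where n=0]
    unfolding P_def by (simp_all add: numeral_eq_Suc)
  \<comment> \<open>The second difference of $s_+^2$ is 2 for $s\ge 2$, so \<open>T'\<close> vanishes beyond $m+2$.\<close>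
  define T where "T t = t - (P 3 m t - 2 * P 3 (m + 1) t + P 3 (m + 2) t) / 6" for t
  define T' where "T' t = 1 - (P 2 m t - 2 * P 2 (m + 1) t + P 2 (m + 2) t) / 2" for t
  define T'' where "T'' t = - (P 1 m t - 2 * P 1 (m + 1) t + P 1 (m + 2) t)" for t
  have "(T has_real_derivative T' t) (at t)" for t
    unfolding T_def T'_def by (auto intro!: derivative_eq_intros dP simp: field_simps)
  moreover have "(T' has_real_derivative T'' t) (at t)" for t
    unfolding T'_def T''_def by (auto intro!: derivative_eq_intros dP simp: field_simps)
  moreover have "continuous_on UNIV T''"
    unfolding T''_def P_def by (intro continuous_intros)
  moreover have "T' t = 0" if "t \<ge> m + 2" for t
    using that by (simp add: T'_def P_def max_def power2_eq_square algebra_simps)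
  ultimately have "C2_truncation T T' T''"
    unfolding C2_truncation_def by blast
  moreover have "T t = t" "T' t = 1" "T'' t = 0" if "t \<le> m" for t
    using that by (simp_all add: T_def T'_def T''_def P_def)
  moreover have "T t \<ge> m" if "t \<ge> m" for t
  proof -
    define s where "s = t - m"
    have T: "T t - m = s - (max 0 s ^ 3 - 2 * max 0 (s - 1) ^ 3 + max 0 (s - 2) ^ 3) / 6"
      by (simp add: T_def P_def s_def algebra_simps)
    have s: "s \<ge> 0" using that by (simp add: s_def)
    \<comment> \<open>Up to s = 2 this is all that is needed: s - s^3/6 is already nonnegative, and
      the term with (s-1)^3 only increases the value.\<close>
    have cube: "s ^ 3 \<le> 4 * s" if "s \<le> 2"
    proof -
      have "s * s \<le> 2 * 2" using s that by (intro mult_mono) auto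
      from mult_left_mono[OF this s] show ?thesis by (simp add: power3_eq_cube)
    qed
    consider "s \<le> 1" | "1 \<le> s" "s \<le> 2" | "s \<ge> 2" by linarith
    then have "s - (max 0 s ^ 3 - 2 * max 0 (s - 1) ^ 3 + max 0 (s - 2) ^ 3) / 6 \<ge> 0"
    proof cases
      case 1
      then show ?thesis using s cube by simp
    next
      case 2
      then have "max 0 s = s" "max 0 (s - 1) = s - 1" "max 0 (s - 2) = 0" by auto
      then have "s - (max 0 s ^ 3 - 2 * max 0 (s - 1) ^ 3 + max 0 (s - 2) ^ 3) / 6
          = s - (s ^ 3 - 2 * (s - 1) ^ 3) / 6" by simp
      moreover have "s - (s ^ 3 - 2 * c) / 6 \<ge> 0" if "c \<ge> 0" for c
        using s cube[OF 2(2)] that by (simp add: field_simps)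
      ultimately show ?thesis using 2 by (metis diff_ge_0_iff_ge zero_le_power)
    next
      case 3
      \<comment> \<open>Beyond s = 2 the expression equals s - (s - 1) = 1, so \<open>T\<close> has
        reached its final value m + 1.\<close>
      have "s ^ 3 - 2 * (s - 1) ^ 3 + (s - 2) ^ 3 = 6 * s - 6"
        by (simp add: power3_eq_cube algebra_simps)
      then show ?thesis using 3 by (simp add: max_def)
    qed
    then show ?thesis using T by linarith
  qed
  ultimately show ?thesis by (rule that)
qed

text \<open>The function is continued below \<open>a\<close> by its tangent line at
  \<open>a\<close>. Although W \<ge> 1, the nice functions approximating a truncation of
  \<open>W\<close> may take values below 1, so the weights must be C^1 on the whole line.\<close>

lemma C1_extension:
  fixes \<psi> \<psi>' :: "real \<Rightarrow> real"
  assumes deriv: "\<And>t. t \<ge> a \<Longrightarrow> (\<psi> has_real_derivative \<psi>' t) (at t within {a..})"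
    and cont: "continuous_on {a..} \<psi>'"
  obtains \<Psi> \<Psi>' where "\<And>t. (\<Psi> has_real_derivative \<Psi>' t) (at t)" "continuous_on UNIV \<Psi>'"
    "\<And>t. t \<ge> a \<Longrightarrow> \<Psi> t = \<psi> t" "\<And>t. t \<ge> a \<Longrightarrow> \<Psi>' t = \<psi>' t"
proof -
  define l where "l t = \<psi> a + \<psi>' a * (t - a)" for t
  define \<Psi> where "\<Psi> t = (if t \<ge> a then \<psi> t else l t)" for t
  define \<Psi>' where "\<Psi>' t = \<psi>' (max a t)" for t
  have l: "(l has_real_derivative \<psi>' a) (at t within S)" for t S
    unfolding l_def by (auto intro!: derivative_eq_intros)
  have "(\<Psi> has_real_derivative \<Psi>' t) (at t)" for t
  proof -
    consider "t > a" | "t < a" | "t = a" by linarith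
    then show ?thesis
    proof cases
      case 1
      have "(\<psi> has_real_derivative \<psi>' t) (at t)"
        using deriv[of t] 1 at_within_interior[of t "{a..}"] by (simp add: interior_Ici[of "a - 1"])
      then show ?thesis
        by (rule has_field_derivative_transform_within_open[of _ _ _ "{a<..}", THEN DERIV_cong])
          (use 1 in \<open>auto simp: \<Psi>_def \<Psi>'_def\<close>)
    next
      case 2
      show ?thesis
        by (rule has_field_derivative_transform_within_open[OF l, of "{..<a}", THEN DERIV_cong])
          (use 2 in \<open>auto simp: \<Psi>_def \<Psi>'_def\<close>)
    next
      case 3
      have "(\<Psi> has_real_derivative \<psi>' a) (at a within {a..})"
        by (rule has_field_derivative_transform_within[OF deriv, of _ 1]) (auto simp: \<Psi>_def)
      then have R: "(\<Psi> has_real_derivative \<psi>' a) (at_right a)"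
        by (rule DERIV_subset) auto
      have "(\<Psi> has_real_derivative \<psi>' a) (at a within {..a})"
        by (rule has_field_derivative_transform_within[OF l, of 1]) (auto simp: \<Psi>_def l_def)
      then have L: "(\<Psi> has_real_derivative \<psi>' a) (at_left a)"
        by (rule DERIV_subset) auto
      \<comment> \<open>A two-sided limit of the difference quotient is the conjunction of the two
        one-sided ones.\<close>
      from L R show ?thesis
        unfolding 3 \<Psi>'_def by (simp add: has_field_derivative_iff filterlim_split_at)
    qed
  qed
  moreover have "continuous_on UNIV \<Psi>'"
    unfolding \<Psi>'_def by (rule continuous_on_compose2[OF cont]) (auto intro!: continuous_intros)
  ultimately show ?thesis
    by (rule that) (auto simp: \<Psi>_def \<Psi>'_def)
qed

context symmetric_diffusion
begin

section \<open>Limits of the carre du champ along nice functions\<close>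

lemma L_diff:
  assumes "f \<in> \<A>" "g \<in> \<A>"
  shows "AE x in \<mu>. L (\<lambda>y. f y - g y) x = L f x - L g x"
  using L_add[OF alg_dom[OF assms(1)] alg_dom[OF alg_scale[OF assms(2), of "-1"]]]
    L_scale[OF alg_dom[OF assms(2)], of "-1"]
  by eventually_elim simp

text \<open>
  Since $v$ need not be nice, \<open>G1\<close> and \<open>G2\<close> play the roles of $\Gamma(f,v)$ and $\Gamma(v)$; the
  quadratic inequality stands for Cauchy-Schwarz.
\<close>

lemma gamma_limit:
  assumes f: "f \<in> \<A>" and h: "\<And>k. h k \<in> \<A>" and K: "\<And>k x. \<bar>h k x\<bar> \<le> K"
    and v[measurable]: "v \<in> borel_measurable \<mu>" and u[measurable]: "u \<in> borel_measurable \<mu>"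
    and hv: "AE x in \<mu>. (\<lambda>k. h k x) \<longlonglongrightarrow> v x"
    and Lh: "(\<lambda>k. \<integral>\<^sup>+ x. ennreal \<bar>L (h k) x - u x\<bar> \<partial>\<mu>) \<longlonglongrightarrow> 0"
  obtains G1 G2 where "integrable \<mu> G1" "integrable \<mu> G2" "integrable \<mu> u"
    "AE x in \<mu>. \<forall>q. 0 \<le> \<Gamma> f f x + 2 * q * G1 x + q\<^sup>2 * G2 x"
    "\<And>\<psi> \<psi>'. (\<And>t. (\<psi> has_real_derivative \<psi>' t) (at t)) \<Longrightarrow> continuous_on UNIV \<psi>' \<Longrightarrow>
      - (\<integral>x. (f x)\<^sup>2 * \<psi> (v x) * u x \<partial>\<mu>)
      = (\<integral>x. 2 * f x * \<psi> (v x) * G1 x + (f x)\<^sup>2 * \<psi>' (v x) * G2 x \<partial>\<mu>)"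
    "AE x in \<mu>. \<bar>v x\<bar> \<le> K"
proof -
  \<comment> \<open>A subsequence converging at rate 4^-k: the energies of its increments are then
    O(4^-k), and Young with t = 2^-k leaves L^1 increments of order 2^-k, as required for almost
    everywhere convergence with a majorant.\<close>
  have "\<exists>r\<ge>k. (\<integral>\<^sup>+ x. ennreal \<bar>L (h r) x - u x\<bar> \<partial>\<mu>) < ennreal ((1/4) ^ k)" for k
  proof -
    have "\<forall>\<^sub>F r in sequentially. (\<integral>\<^sup>+ x. ennreal \<bar>L (h r) x - u x\<bar> \<partial>\<mu>) < ennreal ((1/4) ^ k)"
      by (rule order_tendstoD(2)[OF Lh]) simp
    from eventually_conj[OF this eventually_ge_at_top[of k]] show ?thesis
      using eventually_happens by force
  qed
  then obtain r where r: "\<And>k. r k \<ge> k"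
      "\<And>k. (\<integral>\<^sup>+ x. ennreal \<bar>L (h (r k)) x - u x\<bar> \<partial>\<mu>) < ennreal ((1/4) ^ k)"
    by metis
  have r_top: "filterlim r at_top sequentially"
    by (rule filterlim_at_top_mono[OF filterlim_ident]) (simp add: r(1))
  define g where "g k = h (r k)" for k
  have g: "g k \<in> \<A>" and gK: "\<bar>g k x\<bar> \<le> K" for k x
    using h K by (auto simp: g_def)
  have K0: "0 \<le> K" using K[of 0 undefined] by linarith
  have gv: "AE x in \<mu>. (\<lambda>k. g k x) \<longlonglongrightarrow> v x"
    using hv by eventually_elim (auto simp: g_def intro: filterlim_compose[OF _ r_top])
  note [measurable] = alg_measurable[OF f] alg_measurable[OF g] gamma_measurable[OF f f]
    gamma_measurable[OF f g] gamma_measurable[OF g g] borel_measurable_integrable[OF L_integrable[OF g]]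
  have nn: "(\<integral>\<^sup>+ x. ennreal \<bar>L (g k) x - u x\<bar> \<partial>\<mu>) < ennreal ((1/4) ^ k)" for k
    using r(2) by (simp add: g_def)
  have Lu_int: "integrable \<mu> (\<lambda>x. L (g k) x - u x)" for k
    using nn[of k] by (intro integrableI_bounded) (auto simp: order.strict_trans)
  have Lu: "(\<integral>x. \<bar>L (g k) x - u x\<bar> \<partial>\<mu>) \<le> (1/4) ^ k" for k
  proof -
    have "ennreal (\<integral>x. \<bar>L (g k) x - u x\<bar> \<partial>\<mu>) = (\<integral>\<^sup>+ x. ennreal \<bar>L (g k) x - u x\<bar> \<partial>\<mu>)"
      by (rule nn_integral_eq_integral[symmetric]) (use Lu_int in auto)
    also have "\<dots> \<le> ennreal ((1/4) ^ k)" using nn[of k] by simp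
    finally show ?thesis by (subst (asm) ennreal_le_iff) auto
  qed
  have u_int: "integrable \<mu> u"
    using Bochner_Integration.integrable_diff[OF L_integrable[OF g[of 0]] Lu_int[of 0]] by simp
  \<comment> \<open>Differences have small energy and sums have bounded energy. By polarization,
    mixed terms of the two control the increments of \<Gamma>(g_k).\<close>
  define d where "d k = (\<lambda>x. g (Suc k) x - g k x)" for k
  define s where "s k = (\<lambda>x. g (Suc k) x + g k x)" for k
  have d: "d k \<in> \<A>" and s: "s k \<in> \<A>" for k
    unfolding d_def s_def by (intro alg_diff alg_add g)+
  have dK: "\<bar>d k x\<bar> \<le> 2 * K" and sK: "\<bar>s k x\<bar> \<le> 2 * K" for k x
    using gK[of k x] gK[of "Suc k" x] by (auto simp: d_def s_def)
  have pow4: "(1/4::real) ^ Suc k \<le> (1/4) ^ k" "(1/4::real) ^ k \<le> 1" for k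
    by (auto intro: power_le_one)
  have Ld: "(\<integral>x. \<bar>L (d k) x\<bar> \<partial>\<mu>) \<le> 2 * (1/4) ^ k" for k
  proof -
    have "(\<integral>x. \<bar>L (d k) x\<bar> \<partial>\<mu>) \<le> (\<integral>x. \<bar>L (g (Suc k)) x - u x\<bar> + \<bar>L (g k) x - u x\<bar> \<partial>\<mu>)"
    proof (rule integral_mono_AE)
      show "AE x in \<mu>. \<bar>L (d k) x\<bar> \<le> \<bar>L (g (Suc k)) x - u x\<bar> + \<bar>L (g k) x - u x\<bar>"
        using L_diff[OF g[of "Suc k"] g[of k]] unfolding d_def by eventually_elim auto
    qed (intro integrable_abs Bochner_Integration.integrable_add L_integrable d Lu_int)+
    also have "\<dots> = (\<integral>x. \<bar>L (g (Suc k)) x - u x\<bar> \<partial>\<mu>) + (\<integral>x. \<bar>L (g k) x - u x\<bar> \<partial>\<mu>)"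
      by (intro Bochner_Integration.integral_add integrable_abs Lu_int)
    also have "\<dots> \<le> 2 * (1/4) ^ k" using Lu[of k] Lu[of "Suc k"] pow4(1)[of k] by linarith
    finally show ?thesis .
  qed
  define U where "U = (\<integral>x. \<bar>u x\<bar> \<partial>\<mu>)"
  have Ls: "(\<integral>x. \<bar>L (s k) x\<bar> \<partial>\<mu>) \<le> 2 * U + 2" for k
  proof -
    have "(\<integral>x. \<bar>L (s k) x\<bar> \<partial>\<mu>) \<le> (\<integral>x. \<bar>L (g (Suc k)) x - u x\<bar> + \<bar>L (g k) x - u x\<bar> + 2 * \<bar>u x\<bar> \<partial>\<mu>)"
    proof (rule integral_mono_AE)
      show "AE x in \<mu>. \<bar>L (s k) x\<bar> \<le> \<bar>L (g (Suc k)) x - u x\<bar> + \<bar>L (g k) x - u x\<bar> + 2 * \<bar>u x\<bar>"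
        using L_add[OF alg_dom[OF g[of "Suc k"]] alg_dom[OF g[of k]]]
        unfolding s_def by eventually_elim auto
    qed (intro integrable_abs Bochner_Integration.integrable_add integrable_mult_right L_integrable s Lu_int u_int)+
    also have "\<dots> = (\<integral>x. \<bar>L (g (Suc k)) x - u x\<bar> \<partial>\<mu>) + (\<integral>x. \<bar>L (g k) x - u x\<bar> \<partial>\<mu>) + 2 * U"
      using integrable_abs[OF Lu_int] integrable_abs[OF u_int] by (simp add: U_def)
    also have "\<dots> \<le> 2 * U + 2" using Lu[of k] Lu[of "Suc k"] pow4[of k] by linarith
    finally show ?thesis .
  qed
  have E: "(\<integral>x. \<Gamma> (d k) (d k) x \<partial>\<mu>) \<le> 4 * K * (1/4) ^ k" for k
    using integral_gamma_le[OF d[of k] dK] mult_left_mono[OF Ld[of k], of "2 * K"] K0 by simp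
  have S: "(\<integral>x. \<Gamma> (s k) (s k) x \<partial>\<mu>) \<le> 2 * K * (2 * U + 2)" for k
    using integral_gamma_le[OF s[of k] sK] mult_left_mono[OF Ls[of k], of "2 * K"] K0 by simp
  have E': "(\<integral>x. \<Gamma> (d k) (d k) x \<partial>\<mu>) / (1/2) ^ k \<le> 4 * K * (1/2) ^ k" for k
  proof -
    have "(1/4::real) ^ k = (1/2) ^ k * (1/2) ^ k" by (simp flip: power_mult_distrib)
    then show ?thesis using E[of k] by (simp add: pos_divide_le_eq mult.assoc)
  qed
  have fd: "(\<integral>x. \<bar>\<Gamma> f (g (Suc k)) x - \<Gamma> f (g k) x\<bar> \<partial>\<mu>) \<le> ((\<integral>x. \<Gamma> f f x \<partial>\<mu>) + 4 * K) / 2 * (1/2) ^ k" for k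
  proof -
    have AE: "AE x in \<mu>. \<Gamma> f (g (Suc k)) x - \<Gamma> f (g k) x = \<Gamma> f (d k) x"
      using gamma_add_left[OF d[of k] g[of k] f] by eventually_elim (simp add: d_def gamma_commute[of f])
    have "(\<integral>x. \<bar>\<Gamma> f (g (Suc k)) x - \<Gamma> f (g k) x\<bar> \<partial>\<mu>) = (\<integral>x. \<bar>\<Gamma> f (d k) x\<bar> \<partial>\<mu>)"
      by (rule integral_cong_AE) (use AE gamma_measurable[OF f d] in auto)
    also have "\<dots> \<le> ((\<integral>x. \<Gamma> f f x \<partial>\<mu>) * (1/2) ^ k + (\<integral>x. \<Gamma> (d k) (d k) x \<partial>\<mu>) / (1/2) ^ k) / 2"
      by (rule integral_abs_gamma_le[OF f d]) simp
    also have "\<dots> \<le> ((\<integral>x. \<Gamma> f f x \<partial>\<mu>) * (1/2) ^ k + 4 * K * (1/2) ^ k) / 2"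
      by (intro divide_right_mono add_mono order_refl E') simp
    finally show ?thesis by (simp add: algebra_simps add_divide_distrib)
  qed
  have gg: "(\<integral>x. \<bar>\<Gamma> (g (Suc k)) (g (Suc k)) x - \<Gamma> (g k) (g k) x\<bar> \<partial>\<mu>) \<le> (2 * K * (2 * U + 2) + 4 * K) / 2 * (1/2) ^ k" for k
  proof -
    have AE: "AE x in \<mu>. \<Gamma> (g (Suc k)) (g (Suc k)) x - \<Gamma> (g k) (g k) x = \<Gamma> (s k) (d k) x"
      using gamma_diff_square[OF g g] unfolding s_def d_def .
    have "(\<integral>x. \<bar>\<Gamma> (g (Suc k)) (g (Suc k)) x - \<Gamma> (g k) (g k) x\<bar> \<partial>\<mu>) = (\<integral>x. \<bar>\<Gamma> (s k) (d k) x\<bar> \<partial>\<mu>)"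
      by (rule integral_cong_AE) (use AE gamma_measurable[OF s d] in auto)
    also have "\<dots> \<le> ((\<integral>x. \<Gamma> (s k) (s k) x \<partial>\<mu>) * (1/2) ^ k + (\<integral>x. \<Gamma> (d k) (d k) x \<partial>\<mu>) / (1/2) ^ k) / 2"
      by (rule integral_abs_gamma_le[OF s d]) simp
    also have "\<dots> \<le> (2 * K * (2 * U + 2) * (1/2) ^ k + 4 * K * (1/2) ^ k) / 2"
      by (intro divide_right_mono add_mono mult_right_mono S E') auto
    finally show ?thesis by (simp add: algebra_simps add_divide_distrib)
  qed
  obtain G1 w1 where G1: "integrable \<mu> G1" "integrable \<mu> w1"
      "AE x in \<mu>. (\<lambda>k. \<Gamma> f (g k) x) \<longlonglongrightarrow> G1 x" "\<And>k. AE x in \<mu>. \<bar>\<Gamma> f (g k) x\<bar> \<le> w1 x"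
    by (rule fast_L1_Cauchy_dominated[OF gamma_integrable[OF f g] fd]) blast
  obtain G2 w2 where G2: "integrable \<mu> G2" "integrable \<mu> w2"
      "AE x in \<mu>. (\<lambda>k. \<Gamma> (g k) (g k) x) \<longlonglongrightarrow> G2 x" "\<And>k. AE x in \<mu>. \<bar>\<Gamma> (g k) (g k) x\<bar> \<le> w2 x"
    by (rule fast_L1_Cauchy_dominated[OF gamma_integrable[OF g g] gg]) blast
  note [measurable] = borel_measurable_integrable[OF G1(1)] borel_measurable_integrable[OF G2(1)]
  \<comment> \<open>Restricting to rational \<open>q\<close> makes the union of the exceptional sets
    null. After the limit in \<open>k\<close>, continuity in \<open>q\<close> restores all real
    values.\<close>
  have "AE x in \<mu>. \<forall>q\<in>\<rat>. \<forall>k. 0 \<le> \<Gamma> f f x + 2 * q * \<Gamma> f (g k) x + q\<^sup>2 * \<Gamma> (g k) (g k) x"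
    by (subst AE_ball_countable[OF countable_rat])
      (intro ballI AE_all_countable[THEN iffD2] allI gamma_quadratic_nonneg f g)
  with G1(3) G2(3) have quad: "AE x in \<mu>. \<forall>q. 0 \<le> \<Gamma> f f x + 2 * q * G1 x + q\<^sup>2 * G2 x"
  proof eventually_elim
    case (elim x)
    have rat: "0 \<le> \<Gamma> f f x + 2 * q * G1 x + q\<^sup>2 * G2 x" if "q \<in> \<rat>" for q
    proof (rule LIMSEQ_le_const)
      show "(\<lambda>k. \<Gamma> f f x + 2 * q * \<Gamma> f (g k) x + q\<^sup>2 * \<Gamma> (g k) (g k) x)
          \<longlonglongrightarrow> \<Gamma> f f x + 2 * q * G1 x + q\<^sup>2 * G2 x"
        using elim(1,2) by (intro tendsto_intros)
      show "\<exists>N. \<forall>n\<ge>N. 0 \<le> \<Gamma> f f x + 2 * q * \<Gamma> f (g n) x + q\<^sup>2 * \<Gamma> (g n) (g n) x"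
        using elim(3) that by blast
    qed
    have "0 \<le> \<Gamma> f f x + 2 * q * G1 x + q\<^sup>2 * G2 x" for q
      by (rule continuous_ge_on_closure[where S="\<rat>" and f="\<lambda>q. \<Gamma> f f x + 2 * q * G1 x + q\<^sup>2 * G2 x"])
        (auto intro!: continuous_intros rat simp: Rats_closure_real)
    then show ?case by blast
  qed
  have vK: "AE x in \<mu>. \<bar>v x\<bar> \<le> K"
    using gv by eventually_elim (rule tendsto_upperbound[OF tendsto_rabs], auto simp: gK)
  have main: "- (\<integral>x. (f x)\<^sup>2 * \<psi> (v x) * u x \<partial>\<mu>)
      = (\<integral>x. 2 * f x * \<psi> (v x) * G1 x + (f x)\<^sup>2 * \<psi>' (v x) * G2 x \<partial>\<mu>)"
    if deriv: "\<And>t. (\<psi> has_real_derivative \<psi>' t) (at t)" and cont: "continuous_on UNIV \<psi>'" for \<psi> \<psi>'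
  proof -
    have cont\<psi>: "continuous_on UNIV \<psi>"
      using deriv by (intro DERIV_continuous_on[where D=\<psi>']) (auto intro: has_field_derivative_at_within)
    obtain B where B: "\<And>t. \<bar>t\<bar> \<le> K \<Longrightarrow> \<bar>\<psi> t\<bar> \<le> B" using continuous_bounded_Icc[OF cont\<psi>] by blast
    obtain B' where B': "\<And>t. \<bar>t\<bar> \<le> K \<Longrightarrow> \<bar>\<psi>' t\<bar> \<le> B'" using continuous_bounded_Icc[OF cont] by blast
    have B0: "0 \<le> B" using B[of 0] K0 by auto
    obtain F where F: "\<And>x. \<bar>f x\<bar> \<le> F" using alg_bounded[OF f] by blast
    have F0: "0 \<le> F" using F[of undefined] by linarith
    have F2: "(f x)\<^sup>2 \<le> F\<^sup>2" for x using F[of x] by (metis abs_ge_zero power2_abs power_mono)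
    have [measurable]: "(\<lambda>x. \<psi> (k x)) \<in> borel_measurable \<mu>" "(\<lambda>x. \<psi>' (k x)) \<in> borel_measurable \<mu>"
      if "k \<in> borel_measurable \<mu>" for k
      using that cont cont\<psi> by (auto intro: borel_measurable_continuous_on)
    have lim\<psi>: "AE x in \<mu>. (\<lambda>k. \<psi> (g k x)) \<longlonglongrightarrow> \<psi> (v x)" "AE x in \<mu>. (\<lambda>k. \<psi>' (g k x)) \<longlonglongrightarrow> \<psi>' (v x)"
      using gv by (eventually_elim, use cont\<psi> cont in \<open>auto intro: continuous_on_tendsto_compose\<close>)+
    have A: "(\<lambda>k. \<integral>x. (f x)\<^sup>2 * \<psi> (g k x) * u x \<partial>\<mu>) \<longlonglongrightarrow> (\<integral>x. (f x)\<^sup>2 * \<psi> (v x) * u x \<partial>\<mu>)"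
    proof (rule integral_dominated_convergence)
      show "integrable \<mu> (\<lambda>x. F\<^sup>2 * B * \<bar>u x\<bar>)" using u_int by simp
      show "AE x in \<mu>. (\<lambda>k. (f x)\<^sup>2 * \<psi> (g k x) * u x) \<longlonglongrightarrow> (f x)\<^sup>2 * \<psi> (v x) * u x"
        using lim\<psi>(1) by eventually_elim (intro tendsto_intros)
      show "AE x in \<mu>. norm ((f x)\<^sup>2 * \<psi> (g k x) * u x) \<le> F\<^sup>2 * B * \<bar>u x\<bar>" for k
        by (rule AE_I2) (auto simp: abs_mult B0 intro!: mult_mono F2 B gK)
    qed auto
    \<comment> \<open>\<open>L (g k)\<close> is split as its L^1 error plus \<open>u\<close>. The
      error is paired with a uniformly bounded weight, so its contribution is at most a constant
      times 4^-k.\<close>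
    have Z: "(\<lambda>k. \<integral>x. (f x)\<^sup>2 * \<psi> (g k x) * (L (g k) x - u x) \<partial>\<mu>) \<longlonglongrightarrow> 0"
    proof (rule Lim_null_comparison)
      have "(\<lambda>k. F\<^sup>2 * B * (1/4::real) ^ k) \<longlonglongrightarrow> F\<^sup>2 * B * 0"
        by (intro tendsto_intros LIMSEQ_realpow_zero) auto
      then show "(\<lambda>k. F\<^sup>2 * B * (1/4::real) ^ k) \<longlonglongrightarrow> 0" by simp
      have "norm (\<integral>x. (f x)\<^sup>2 * \<psi> (g k x) * (L (g k) x - u x) \<partial>\<mu>) \<le> F\<^sup>2 * B * (1/4) ^ k" for k
      proof -
        have "norm (\<integral>x. (f x)\<^sup>2 * \<psi> (g k x) * (L (g k) x - u x) \<partial>\<mu>) \<le> (\<integral>x. F\<^sup>2 * B * \<bar>L (g k) x - u x\<bar> \<partial>\<mu>)"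
        proof (rule order_trans[OF integral_norm_bound integral_mono_AE'])
          show "AE x in \<mu>. norm ((f x)\<^sup>2 * \<psi> (g k x) * (L (g k) x - u x)) \<le> F\<^sup>2 * B * \<bar>L (g k) x - u x\<bar>"
            by (rule AE_I2) (auto simp: abs_mult B0 intro!: mult_mono F2 B gK)
        qed (use Lu_int B0 in auto)
        also have "\<dots> \<le> F\<^sup>2 * B * (1/4) ^ k"
          using mult_left_mono[OF Lu[of k], of "F\<^sup>2 * B"] B0 by simp
        finally show ?thesis .
      qed
      then show "\<forall>\<^sub>F k in sequentially. norm (\<integral>x. (f x)\<^sup>2 * \<psi> (g k x) * (L (g k) x - u x) \<partial>\<mu>) \<le> F\<^sup>2 * B * (1/4) ^ k"
        by simp
    qed
    have "(\<integral>x. (f x)\<^sup>2 * \<psi> (g k x) * L (g k) x \<partial>\<mu>)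
        = (\<integral>x. (f x)\<^sup>2 * \<psi> (g k x) * (L (g k) x - u x) \<partial>\<mu>) + (\<integral>x. (f x)\<^sup>2 * \<psi> (g k x) * u x \<partial>\<mu>)" for k
    proof -
      have bd: "AE x in \<mu>. \<bar>(f x)\<^sup>2 * \<psi> (g k x)\<bar> \<le> F\<^sup>2 * B"
        by (rule AE_I2) (auto simp: abs_mult B0 intro!: mult_mono F2 B gK)
      have "integrable \<mu> (\<lambda>x. (f x)\<^sup>2 * \<psi> (g k x) * (L (g k) x - u x))"
        "integrable \<mu> (\<lambda>x. (f x)\<^sup>2 * \<psi> (g k x) * u x)"
        by (auto intro!: integrable_bounded_mult[OF _ _ bd] Lu_int u_int)
      from Bochner_Integration.integral_add[OF this] show ?thesis
        by (simp add: right_diff_distrib)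
    qed
    with tendsto_add[OF Z A] have
      "(\<lambda>k. - (\<integral>x. (f x)\<^sup>2 * \<psi> (g k x) * L (g k) x \<partial>\<mu>)) \<longlonglongrightarrow> - (\<integral>x. (f x)\<^sup>2 * \<psi> (v x) * u x \<partial>\<mu>)"
      by (intro tendsto_minus) simp
    moreover have "(\<lambda>k. \<integral>x. 2 * f x * \<psi> (g k x) * \<Gamma> f (g k) x + (f x)\<^sup>2 * \<psi>' (g k x) * \<Gamma> (g k) (g k) x \<partial>\<mu>)
      \<longlonglongrightarrow> (\<integral>x. 2 * f x * \<psi> (v x) * G1 x + (f x)\<^sup>2 * \<psi>' (v x) * G2 x \<partial>\<mu>)"
    proof (rule integral_dominated_convergence)
      show "integrable \<mu> (\<lambda>x. 2 * F * B * w1 x + F\<^sup>2 * B' * w2 x)" using G1(2) G2(2) by simp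
      show "AE x in \<mu>. (\<lambda>k. 2 * f x * \<psi> (g k x) * \<Gamma> f (g k) x + (f x)\<^sup>2 * \<psi>' (g k x) * \<Gamma> (g k) (g k) x)
          \<longlonglongrightarrow> 2 * f x * \<psi> (v x) * G1 x + (f x)\<^sup>2 * \<psi>' (v x) * G2 x"
        using lim\<psi> G1(3) G2(3) by eventually_elim (intro tendsto_intros)
      fix k
      show "AE x in \<mu>. norm (2 * f x * \<psi> (g k x) * \<Gamma> f (g k) x + (f x)\<^sup>2 * \<psi>' (g k x) * \<Gamma> (g k) (g k) x)
          \<le> 2 * F * B * w1 x + F\<^sup>2 * B' * w2 x"
        using G1(4)[of k] G2(4)[of k]
      proof eventually_elim
        case (elim x)
        have "\<bar>2 * f x * \<psi> (g k x) * \<Gamma> f (g k) x\<bar> \<le> 2 * F * B * w1 x"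
          unfolding abs_mult by (intro mult_mono elim B gK F) (auto simp: F0 B0)
        moreover have "\<bar>(f x)\<^sup>2 * \<psi>' (g k x) * \<Gamma> (g k) (g k) x\<bar> \<le> F\<^sup>2 * B' * w2 x"
          unfolding abs_mult using B'[OF gK, of k x]
          by (intro mult_mono elim B' gK) (auto simp: F2)
        ultimately show ?case unfolding real_norm_def by linarith
      qed
    qed auto
    ultimately show ?thesis
      unfolding weighted_parts_C1[OF f g deriv cont] using LIMSEQ_unique by blast
  qed
  show ?thesis by (rule that[OF G1(1) G2(1) u_int quad main vK])
qed

end

section \<open>The Lyapunov inequality\<close>

text \<open>The value of \<open>g\<close> below \<open>a\<close> is arbitrary; composing with
  \<open>max a\<close> gives a function continuous on the line that agrees with \<open>g\<close> on
  the range of \<open>W\<close>.\<close>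

lemma borel_measurable_compose_Ici:
  fixes g :: "real \<Rightarrow> real"
  assumes "continuous_on {a..} g" "W \<in> borel_measurable M" "\<And>x. a \<le> W x"
  shows "(\<lambda>x. g (W x)) \<in> borel_measurable M"
proof -
  have "continuous_on UNIV (\<lambda>t. g (max a t))"
    by (rule continuous_on_compose2[OF assms(1)]) (auto intro!: continuous_intros)
  from borel_measurable_continuous_on[OF this assms(2)] show ?thesis
    using assms(3) by (simp add: max_absorb2)
qed

section \<open>Nonnegative quadratics and the pointwise Young inequality\<close>

lemma nonneg_quadratic_leading:
  fixes A B C :: real
  assumes "\<And>q. 0 \<le> A + 2 * q * B + q\<^sup>2 * C"
  shows "0 \<le> C"
proof (rule ccontr)
  assume "\<not> 0 \<le> C"
  then have C: "C < 0" by simp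
  have A: "0 \<le> A" using assms[of 0] by simp
  \<comment> \<open>Adding the inequalities at \<open>q\<close> and \<open>- q\<close> cancels the
    linear term and leaves 2A - 2(A+1) < 0.\<close>
  define q where "q = sqrt ((A + 1) / (- C))"
  have "q\<^sup>2 * C = - (A + 1)" using C A by (simp add: q_def field_simps)
  then show False using assms[of q] assms[of "- q"] by simp
qed

lemma nonneg_quadratic_degenerate:
  fixes B C :: real
  assumes "\<And>q. 0 \<le> 2 * q * B + q\<^sup>2 * C"
  shows "B = 0"
proof (rule ccontr)
  assume B: "B \<noteq> 0"
  have C: "0 \<le> C" by (rule nonneg_quadratic_leading[of 0 B]) (simp add: assms)
  \<comment> \<open>The minimizer would be -B/C, but \<open>C\<close> may be 0; dividing by C + 1
    still gives a negative value.\<close>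
  have "2 * (- B / (C + 1)) * B + (- B / (C + 1))\<^sup>2 * C = - (B\<^sup>2 * (C + 2)) / (C + 1)\<^sup>2"
    using C by (simp add: power2_eq_square divide_simps) (simp add: algebra_simps)
  also have "\<dots> < 0" using B C by (simp add: divide_less_0_iff)
  finally show False using assms[of "- B / (C + 1)"] by simp
qed

text \<open>The quadratic is evaluated at q = - y d and divided by \<open>d\<close>. For d = 0 the
  right-hand side is 0 by convention, so \<open>A\<close> must vanish; then the quadratic forces G1
  = 0. It is used with y = f/w(W) and d = w'(W).\<close>

lemma quadratic_young:
  fixes A G1 G2 y d :: real
  assumes quad: "\<And>q. 0 \<le> A + 2 * q * G1 + q\<^sup>2 * G2" and "0 \<le> d" and "d = 0 \<Longrightarrow> A = 0"
  shows "2 * y * G1 - y\<^sup>2 * d * G2 \<le> A / d"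
proof (cases "d = 0")
  case True
  then have "G1 = 0" using quad assms(3) nonneg_quadratic_degenerate[of G1 G2] by simp
  then show ?thesis using True by simp
next
  case False
  then have d: "d > 0" using assms by simp
  have "(2 * y * G1 - y\<^sup>2 * d * G2) * d = - (2 * (- y * d) * G1 + (- y * d)\<^sup>2 * G2)"
    by (simp add: power2_eq_square algebra_simps)
  also have "\<dots> \<le> A" using quad[of "- y * d"] by simp
  finally show ?thesis using d by (simp add: pos_le_divide_eq)
qed

context symmetric_diffusion
begin

text \<open>\<open>LW\<close> itself need not be integrable. Only its products with weights
  vanishing at large values of \<open>W\<close> are controlled, hence the integrability claims next
  to the identity, from which \<open>T\<close> has disappeared.\<close>

lemma lyapunov_parts:
  assumes f: "f \<in> \<A>" and sm: "smooth_enough \<mu> \<A> L W LW" and W1: "\<And>x. W x \<ge> 1"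
    and deriv: "\<And>t. t \<ge> 1 \<Longrightarrow> (\<psi> has_real_derivative \<psi>' t) (at t within {1..})"
    and cont: "continuous_on {1..} \<psi>'"
    and zero: "\<And>t. t \<ge> m \<Longrightarrow> \<psi> t = 0" "\<And>t. t \<ge> m \<Longrightarrow> \<psi>' t = 0" and "m \<ge> 1"
  obtains G1 G2 where
    "AE x in \<mu>. \<forall>q. 0 \<le> \<Gamma> f f x + 2 * q * G1 x + q\<^sup>2 * G2 x"
    "integrable \<mu> (\<lambda>x. (f x)\<^sup>2 * \<psi> (W x) * LW x)"
    "integrable \<mu> (\<lambda>x. 2 * f x * \<psi> (W x) * G1 x + (f x)\<^sup>2 * \<psi>' (W x) * G2 x)"
    "- (\<integral>x. (f x)\<^sup>2 * \<psi> (W x) * LW x \<partial>\<mu>)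
      = (\<integral>x. 2 * f x * \<psi> (W x) * G1 x + (f x)\<^sup>2 * \<psi>' (W x) * G2 x \<partial>\<mu>)"
proof -
  obtain \<Psi> \<Psi>' where \<Psi>: "\<And>t. (\<Psi> has_real_derivative \<Psi>' t) (at t)" "continuous_on UNIV \<Psi>'"
      "\<And>t. t \<ge> 1 \<Longrightarrow> \<Psi> t = \<psi> t" "\<And>t. t \<ge> 1 \<Longrightarrow> \<Psi>' t = \<psi>' t"
    by (rule C1_extension[OF deriv cont]) auto
  obtain T T' T'' where T: "C2_truncation T T' T''"
    "\<And>t. t \<le> m \<Longrightarrow> T t = t" "\<And>t. t \<le> m \<Longrightarrow> T' t = 1" "\<And>t. t \<le> m \<Longrightarrow> T'' t = 0"
    "\<And>t. t \<ge> m \<Longrightarrow> T t \<ge> m"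
    by (rule truncation_exists[of m]) blast
  from sm obtain \<Gamma>W where [measurable]: "W \<in> borel_measurable \<mu>" "LW \<in> borel_measurable \<mu>" "\<Gamma>W \<in> borel_measurable \<mu>"
    and sm': "\<And>T T' T''. C2_truncation T T' T'' \<Longrightarrow>
        (\<exists>h :: nat \<Rightarrow> real ^ 'n \<Rightarrow> real.
          (\<forall>k. h k \<in> \<A>) \<and>
          (\<exists>K. \<forall>k x. \<bar>h k x\<bar> \<le> K) \<and>
          (AE x in \<mu>. (\<lambda>k. h k x) \<longlonglongrightarrow> T (W x)) \<and>
          (\<lambda>k. \<integral>\<^sup>+ x. ennreal \<bar>L (h k) x - (T' (W x) * LW x + T'' (W x) * \<Gamma>W x)\<bar> \<partial>\<mu>)
            \<longlonglongrightarrow> 0)"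
    unfolding smooth_enough_def by blast
  obtain h K where h: "\<And>k. h k \<in> \<A>" "\<And>k x. \<bar>h k x\<bar> \<le> K" "AE x in \<mu>. (\<lambda>k. h k x) \<longlonglongrightarrow> T (W x)"
      "(\<lambda>k. \<integral>\<^sup>+ x. ennreal \<bar>L (h k) x - (T' (W x) * LW x + T'' (W x) * \<Gamma>W x)\<bar> \<partial>\<mu>) \<longlonglongrightarrow> 0"
    using sm'[OF T(1)] by blast
  have cT: "continuous_on UNIV T" "continuous_on UNIV T'" "continuous_on UNIV T''"
    using T(1) unfolding C2_truncation_def
    by (auto intro!: DERIV_continuous_on intro: has_field_derivative_at_within)
  have c\<Psi>: "continuous_on UNIV \<Psi>"
    using \<Psi>(1) by (intro DERIV_continuous_on[where D=\<Psi>']) (auto intro: has_field_derivative_at_within)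
  define v where "v x = T (W x)" for x
  define u where "u x = T' (W x) * LW x + T'' (W x) * \<Gamma>W x" for x
  have [measurable]: "v \<in> borel_measurable \<mu>" "(\<lambda>x. T' (W x)) \<in> borel_measurable \<mu>" "(\<lambda>x. T'' (W x)) \<in> borel_measurable \<mu>"
    unfolding v_def using cT by (auto intro: borel_measurable_continuous_on)
  have [measurable]: "u \<in> borel_measurable \<mu>" unfolding u_def by measurable
  obtain G1 G2 where G: "integrable \<mu> G1" "integrable \<mu> G2" "integrable \<mu> u"
    "AE x in \<mu>. \<forall>q. 0 \<le> \<Gamma> f f x + 2 * q * G1 x + q\<^sup>2 * G2 x"
    "- (\<integral>x. (f x)\<^sup>2 * \<Psi> (v x) * u x \<partial>\<mu>)
      = (\<integral>x. 2 * f x * \<Psi> (v x) * G1 x + (f x)\<^sup>2 * \<Psi>' (v x) * G2 x \<partial>\<mu>)"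
    "AE x in \<mu>. \<bar>v x\<bar> \<le> K"
    by (rule gamma_limit[OF f h(1,2), of v u]) (use h(3,4) \<Psi>(1,2) in \<open>auto simp: v_def u_def\<close>)
  \<comment> \<open>\<open>T\<close> is the identity up to \<open>m\<close>, and \<open>\<psi>\<close> vanishes beyond: the truncation is not seen.\<close>
  have eq: "\<Psi> (v x) * u x = \<psi> (W x) * LW x" "\<Psi> (v x) = \<psi> (W x)" "\<Psi>' (v x) = \<psi>' (W x)" for x
  proof -
    consider "W x \<le> m" | "W x \<ge> m" by linarith
    then have "\<Psi> (v x) * u x = \<psi> (W x) * LW x \<and> \<Psi> (v x) = \<psi> (W x) \<and> \<Psi>' (v x) = \<psi>' (W x)"
    proof cases
      case 1
      then show ?thesis using T(2-4) \<Psi>(3,4) W1[of x] by (simp add: v_def u_def)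
    next
      case 2
      with T(5)[of "W x"] \<open>m \<ge> 1\<close> show ?thesis
        using \<Psi>(3,4)[of "v x"] zero[of "W x"] zero[of "v x"] by (simp add: v_def)
    qed
    then show "\<Psi> (v x) * u x = \<psi> (W x) * LW x" "\<Psi> (v x) = \<psi> (W x)" "\<Psi>' (v x) = \<psi>' (W x)" by auto
  qed
  have ff: "(\<lambda>x. (f x)\<^sup>2) \<in> \<A>" using alg_mult[OF f f] by (simp add: power2_eq_square)
  have f2: "(\<lambda>x. 2 * f x) \<in> \<A>" using alg_scale[OF f] .
  have mult_int: "integrable \<mu> (\<lambda>x. \<Phi> (v x) * k x)" if c: "continuous_on UNIV \<Phi>" and k: "integrable \<mu> k" for \<Phi> :: "real \<Rightarrow> real" and k
  proof -
    obtain B where B: "\<And>t. \<bar>t\<bar> \<le> K \<Longrightarrow> \<bar>\<Phi> t\<bar> \<le> B" using continuous_bounded_Icc[OF c] by blast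
    show ?thesis
    proof (rule integrable_bounded_mult[OF k])
      show "(\<lambda>x. \<Phi> (v x)) \<in> borel_measurable \<mu>"
        by (rule borel_measurable_continuous_on[OF c]) measurable
      show "AE x in \<mu>. \<bar>\<Phi> (v x)\<bar> \<le> B" using G(6) by eventually_elim (rule B)
    qed
  qed
  have "integrable \<mu> (\<lambda>x. (f x)\<^sup>2 * (\<Psi> (v x) * u x))"
    by (intro alg_mult_integrable ff mult_int c\<Psi> G)
  then have i1: "integrable \<mu> (\<lambda>x. (f x)\<^sup>2 * \<psi> (W x) * LW x)" by (simp add: eq(1) mult.assoc)
  have "integrable \<mu> (\<lambda>x. (2 * f x) * (\<Psi> (v x) * G1 x) + (f x)\<^sup>2 * (\<Psi>' (v x) * G2 x))"
    by (intro Bochner_Integration.integrable_add alg_mult_integrable ff f2 mult_int c\<Psi> \<Psi>(2) G(1,2))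
  then have i2: "integrable \<mu> (\<lambda>x. 2 * f x * \<psi> (W x) * G1 x + (f x)\<^sup>2 * \<psi>' (W x) * G2 x)"
    by (simp add: eq mult.assoc)
  have "- (\<integral>x. (f x)\<^sup>2 * \<psi> (W x) * LW x \<partial>\<mu>)
      = (\<integral>x. 2 * f x * \<psi> (W x) * G1 x + (f x)\<^sup>2 * \<psi>' (W x) * G2 x \<partial>\<mu>)"
    using G(5)[unfolded mult.assoc eq(1), unfolded eq(2,3)] by (simp add: mult.assoc)
  with G(4) i1 i2 show ?thesis by (rule that)
qed

lemma ball_sets: "{x. norm x \<le> R} \<in> sets \<mu>"
proof -
  have "{x :: real ^ 'n. norm x \<le> R} = cball 0 R" by auto
  then show ?thesis using sets_eq_borel by simp
qed

text \<open>The formal inequality for the weight 1/w. Since x/0 = 0, \<open>energy\<close> does not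
  see the set where w'(W) = 0; \<open>degen\<close> excludes any energy there, as needed in the
  Young inequality.\<close>

lemma lyapunov_weighted:
  assumes f: "f \<in> \<A>" and sm: "smooth_enough \<mu> \<A> L W LW" and W1: "\<And>x. W x \<ge> 1"
    and \<phi>_cont: "continuous_on {1..} \<phi>" and \<phi>_pos: "\<And>t. t \<ge> 1 \<Longrightarrow> \<phi> t > 0"
    and b: "b \<ge> 0"
    and lyapunov: "AE x in \<mu>. LW x \<le> - \<phi> (W x) + b * indicator {x. norm x \<le> R} x"
    and w_deriv: "\<And>t. t \<ge> 1 \<Longrightarrow> (w has_real_derivative w' t) (at t within {1..})"
    and w_cont: "continuous_on {1..} w'"
    and w_pos: "\<And>t. t \<ge> 1 \<Longrightarrow> w t > 0" and w_mono: "\<And>t. t \<ge> 1 \<Longrightarrow> w 1 \<le> w t"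
    and w'_nonneg: "\<And>t. t \<ge> 1 \<Longrightarrow> 0 \<le> w' t"
    and energy: "integrable \<mu> (\<lambda>x. \<Gamma> f f x / w' (W x))"
    and degen: "AE x in \<mu>. w' (W x) = 0 \<longrightarrow> \<Gamma> f f x = 0"
  shows "integrable \<mu> (\<lambda>x. (f x)\<^sup>2 * (\<phi> (W x) / w (W x)))"
    and "(\<integral>x. (f x)\<^sup>2 * (\<phi> (W x) / w (W x)) \<partial>\<mu>)
      \<le> (\<integral>x. \<Gamma> f f x / w' (W x) \<partial>\<mu>) + b / w 1 * (LINT x:{x. norm x \<le> R}|\<mu>. (f x)\<^sup>2)"
proof -
  define B where "B = {x :: real ^ 'n. norm x \<le> R}"
  have B[measurable]: "B \<in> sets \<mu>" unfolding B_def by (rule ball_sets)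
  have Wm[measurable]: "W \<in> borel_measurable \<mu>" "LW \<in> borel_measurable \<mu>"
    using sm by (auto simp: smooth_enough_def)
  have w_c: "continuous_on {1..} w" by (rule DERIV_continuous_on[OF w_deriv]) auto
  note [measurable] = borel_measurable_compose_Ici[OF \<phi>_cont Wm(1) W1]
    borel_measurable_compose_Ici[OF w_c Wm(1) W1] borel_measurable_compose_Ici[OF w_cont Wm(1) W1]
    alg_measurable[OF f] gamma_measurable[OF f f]
  have ff: "(\<lambda>x. (f x)\<^sup>2) \<in> \<A>" using alg_mult[OF f f] by (simp add: power2_eq_square)
  have ffB: "integrable \<mu> (\<lambda>x. (f x)\<^sup>2 * indicator B x)"
    by (intro alg_mult_integrable ff, rule integrable_const_bound[where B=1]) auto
  define F where "F x = (f x)\<^sup>2 * (\<phi> (W x) / w (W x))" for x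
  have F0: "0 \<le> F x" for x
    using \<phi>_pos[OF W1, of x] w_pos[OF W1, of x] by (simp add: F_def)
  have [measurable]: "F \<in> borel_measurable \<mu>" unfolding F_def by measurable
  \<comment> \<open>A decreasing cutoff: its derivative contributes to the right-hand side with the good sign.\<close>
  define \<theta> where "\<theta> n t = (max 0 (1 - t / real (Suc n)))\<^sup>2" for n t
  define C where "C = (\<integral>x. \<Gamma> f f x / w' (W x) \<partial>\<mu>) + b / w 1 * (LINT x:B|\<mu>. (f x)\<^sup>2)"
  have \<theta>: "0 \<le> \<theta> n t" "t \<ge> 1 \<Longrightarrow> \<theta> n t \<le> 1" for n t
    by (auto simp: \<theta>_def power2_eq_square max_def intro!: mult_le_one)
  have step: "integrable \<mu> (\<lambda>x. \<theta> n (W x) * F x) \<and> (\<integral>x. \<theta> n (W x) * F x \<partial>\<mu>) \<le> C" for n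
  proof -
    define \<psi> where "\<psi> t = \<theta> n t / w t" for t
    define \<psi>' where "\<psi>' t = (2 * max 0 (1 - t / real (Suc n)) * (- (1 / real (Suc n))) * w t - \<theta> n t * w' t) / (w t * w t)" for t
    \<comment> \<open>The square in the cutoff is what makes it C^1 at \<open>Suc n\<close>.\<close>
    have \<theta>_deriv: "(\<theta> n has_real_derivative 2 * max 0 (1 - t / real (Suc n)) * (- (1 / real (Suc n)))) (at t within S)" for t S
    proof -
      have "((\<lambda>t. 1 - t / real (Suc n)) has_real_derivative - (1 / real (Suc n))) (at t within S)"
        by (auto intro!: derivative_eq_intros simp del: of_nat_Suc)
      moreover have "((\<lambda>s. (max 0 s)\<^sup>2) has_real_derivative 2 * max 0 s) (at s)" for s :: real
        using has_real_derivative_max_power[of 0 0 s] by (simp add: numeral_2_eq_2)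
      ultimately show ?thesis
        unfolding \<theta>_def by (rule DERIV_chain2[rotated])
    qed
    have \<psi>_deriv: "(\<psi> has_real_derivative \<psi>' t) (at t within {1..})" if "t \<ge> 1" for t
      unfolding \<psi>_def \<psi>'_def using w_pos[OF that]
      by (intro DERIV_divide \<theta>_deriv w_deriv that) simp
    have \<psi>'_cont: "continuous_on {1..} \<psi>'"
      unfolding \<psi>'_def \<theta>_def using w_pos by (intro continuous_intros w_c w_cont) (auto simp: less_imp_neq[symmetric])
    have zero: "\<psi> t = 0" "\<psi>' t = 0" if "t \<ge> real (Suc n)" for t
    proof -
      have "max 0 (1 - t / real (Suc n)) = 0" using that by (simp add: field_simps)
      then show "\<psi> t = 0" "\<psi>' t = 0" by (simp_all add: \<psi>_def \<psi>'_def \<theta>_def)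
    qed
    obtain G1 G2 where G: "AE x in \<mu>. \<forall>q. 0 \<le> \<Gamma> f f x + 2 * q * G1 x + q\<^sup>2 * G2 x"
      "integrable \<mu> (\<lambda>x. (f x)\<^sup>2 * \<psi> (W x) * LW x)"
      "integrable \<mu> (\<lambda>x. 2 * f x * \<psi> (W x) * G1 x + (f x)\<^sup>2 * \<psi>' (W x) * G2 x)"
      "- (\<integral>x. (f x)\<^sup>2 * \<psi> (W x) * LW x \<partial>\<mu>)
        = (\<integral>x. 2 * f x * \<psi> (W x) * G1 x + (f x)\<^sup>2 * \<psi>' (W x) * G2 x \<partial>\<mu>)"
      by (rule lyapunov_parts[OF f sm W1 \<psi>_deriv \<psi>'_cont zero]) (assumption | simp)+
    \<comment> \<open>The upper bound is the origin of the factor b / w(1) in front of the integral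
      over the ball.\<close>
    have \<psi>_bd: "0 \<le> \<psi> (W x)" "\<psi> (W x) \<le> 1 / w 1" for x
      using \<theta>(1)[of n "W x"] \<theta>(2)[OF W1[of x], of n] w_pos[OF W1, of x] w_mono[OF W1, of x] w_pos[of 1]
      by (auto simp: \<psi>_def intro!: frac_le)
    have rhs: "AE x in \<mu>. 2 * f x * \<psi> (W x) * G1 x + (f x)\<^sup>2 * \<psi>' (W x) * G2 x \<le> \<Gamma> f f x / w' (W x)"
      using G(1) degen gamma_nonneg[OF f]
    proof eventually_elim
      case (elim x)
      define \<omega> where "\<omega> = w (W x)"
      define \<delta> where "\<delta> = w' (W x)"
      have pos: "\<omega> > 0" "\<delta> \<ge> 0" using w_pos w'_nonneg W1 by (auto simp: \<omega>_def \<delta>_def)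
      have G2: "0 \<le> G2 x" using nonneg_quadratic_leading[of "\<Gamma> f f x" "G1 x" "G2 x"] elim(1) by blast
      \<comment> \<open>The contribution of the derivative of the cutoff is nonpositive and is
        dropped; this is legitimate because it is multiplied by f^2 and by \<open>G2 x\<close>, both
        nonnegative.\<close>
      have "\<psi>' (W x) \<le> - (\<theta> n (W x) * \<delta>) / (\<omega> * \<omega>)"
        unfolding \<psi>'_def \<omega>_def[symmetric] \<delta>_def[symmetric] using pos
        by (intro divide_right_mono) (auto simp: mult_nonneg_nonneg)
      from mult_right_mono[OF mult_left_mono[OF this, of "(f x)\<^sup>2"] G2]
      have "2 * f x * \<psi> (W x) * G1 x + (f x)\<^sup>2 * \<psi>' (W x) * G2 x
          \<le> 2 * f x * \<psi> (W x) * G1 x + (f x)\<^sup>2 * (- (\<theta> n (W x) * \<delta>) / (\<omega> * \<omega>)) * G2 x"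
        by simp
      also have "\<dots> = \<theta> n (W x) * (2 * (f x / \<omega>) * G1 x - (f x / \<omega>)\<^sup>2 * \<delta> * G2 x)"
        by (simp add: \<psi>_def \<omega>_def[symmetric] power2_eq_square algebra_simps)
      also have "\<dots> \<le> \<theta> n (W x) * (\<Gamma> f f x / \<delta>)"
        by (rule mult_left_mono[OF quadratic_young \<theta>(1)]) (use elim pos in \<open>auto simp: \<delta>_def\<close>)
      also have "\<dots> \<le> 1 * (\<Gamma> f f x / \<delta>)"
        using elim(3) pos by (intro mult_right_mono \<theta>(2) W1) auto
      finally show ?case by (simp add: \<delta>_def)
    qed
    have eqF: "\<theta> n (W x) * F x = (f x)\<^sup>2 * \<psi> (W x) * \<phi> (W x)" for x
      by (simp add: F_def \<psi>_def)
    have lower: "AE x in \<mu>. \<theta> n (W x) * F x \<le> - ((f x)\<^sup>2 * \<psi> (W x) * LW x) + b / w 1 * ((f x)\<^sup>2 * indicator B x)"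
      using lyapunov
    proof eventually_elim
      case (elim x)
      have "(f x)\<^sup>2 * \<psi> (W x) * \<phi> (W x) \<le> (f x)\<^sup>2 * \<psi> (W x) * (b * indicator B x - LW x)"
        using elim \<psi>_bd(1)[of x] by (intro mult_left_mono) (auto simp: B_def)
      moreover have "\<psi> (W x) * ((f x)\<^sup>2 * b * indicator B x) \<le> 1 / w 1 * ((f x)\<^sup>2 * b * indicator B x)"
        using b by (intro mult_right_mono \<psi>_bd) auto
      ultimately show ?case unfolding eqF by (simp add: algebra_simps)
    qed
    have up_int: "integrable \<mu> (\<lambda>x. - ((f x)\<^sup>2 * \<psi> (W x) * LW x) + b / w 1 * ((f x)\<^sup>2 * indicator B x))"
      using G(2) ffB by simp
    have \<theta>_meas: "(\<lambda>x. \<theta> n (W x)) \<in> borel_measurable \<mu>"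
      unfolding \<theta>_def by measurable
    have int: "integrable \<mu> (\<lambda>x. \<theta> n (W x) * F x)"
    proof (rule Bochner_Integration.integrable_bound[OF up_int])
      show "(\<lambda>x. \<theta> n (W x) * F x) \<in> borel_measurable \<mu>" using \<theta>_meas by measurable
      show "AE x in \<mu>. norm (\<theta> n (W x) * F x)
          \<le> norm (- ((f x)\<^sup>2 * \<psi> (W x) * LW x) + b / w 1 * ((f x)\<^sup>2 * indicator B x))"
        using lower
      proof eventually_elim
        case (elim x)
        have "0 \<le> \<theta> n (W x) * F x" using \<theta>(1) F0 by simp
        with elim show ?case unfolding real_norm_def by linarith
      qed
    qed
    have "(\<integral>x. \<theta> n (W x) * F x \<partial>\<mu>)
        \<le> (\<integral>x. - ((f x)\<^sup>2 * \<psi> (W x) * LW x) + b / w 1 * ((f x)\<^sup>2 * indicator B x) \<partial>\<mu>)"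
      by (rule integral_mono_AE[OF int up_int lower])
    also have "\<dots> = - (\<integral>x. (f x)\<^sup>2 * \<psi> (W x) * LW x \<partial>\<mu>) + b / w 1 * (\<integral>x. (f x)\<^sup>2 * indicator B x \<partial>\<mu>)"
      using G(2) ffB by simp
    also have "\<dots> \<le> C"
      unfolding G(4) C_def set_lebesgue_integral_def
      using integral_mono_AE[OF G(3) energy rhs] by (simp add: mult.commute)
    finally show ?thesis using int by blast
  qed
  \<comment> \<open>For fixed t \<ge> 1 the cutoffs increase to 1 with \<open>n\<close>, and F \<ge>
    0, so the bound \<open>C\<close>, uniform in \<open>n\<close>, gives both the integrability of
    \<open>F\<close> and the bound on its integral.\<close>
  have \<theta>_mono: "\<theta> i t \<le> \<theta> j t" if "i \<le> j" "t \<ge> 1" for i j t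
    unfolding \<theta>_def using that by (intro power_mono max.mono) (auto intro!: divide_left_mono)
  have mono_n: "mono (\<lambda>n. \<theta> n (W x) * F x)" for x
    using \<theta>_mono W1 F0 by (intro monoI mult_right_mono) auto
  have \<theta>_lim: "(\<lambda>n. \<theta> n t) \<longlonglongrightarrow> 1" for t
  proof -
    have "(\<lambda>n. (max 0 (1 - t * inverse (real (Suc n))))\<^sup>2) \<longlonglongrightarrow> (max 0 (1 - t * 0))\<^sup>2"
      by (intro tendsto_intros LIMSEQ_inverse_real_of_nat)
    then show ?thesis unfolding \<theta>_def by (simp add: divide_inverse)
  qed
  have lim_n: "(\<lambda>n. \<theta> n (W x) * F x) \<longlonglongrightarrow> F x" for x
    using tendsto_mult_right[OF \<theta>_lim[of "W x"], of "F x"] by simp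
  have "incseq (\<lambda>n. \<integral>x. \<theta> n (W x) * F x \<partial>\<mu>)"
    using step mono_n by (intro incseq_SucI integral_mono) (auto simp: mono_def)
  then obtain I where I: "(\<lambda>n. \<integral>x. \<theta> n (W x) * F x \<partial>\<mu>) \<longlonglongrightarrow> I"
    by (rule incseq_convergent) (use step in blast)+
  have "integrable \<mu> F"
    by (rule integrable_monotone_convergence[OF _ _ _ I]) (use step mono_n lim_n in auto)
  moreover have "integral\<^sup>L \<mu> F = I"
    by (rule integral_monotone_convergence[OF _ _ _ I]) (use step mono_n lim_n in auto)
  moreover have "I \<le> C"
    by (rule LIMSEQ_le_const2[OF I]) (use step in blast)
  ultimately show "integrable \<mu> (\<lambda>x. (f x)\<^sup>2 * (\<phi> (W x) / w (W x)))"
    "(\<integral>x. (f x)\<^sup>2 * (\<phi> (W x) / w (W x)) \<partial>\<mu>)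
      \<le> (\<integral>x. \<Gamma> f f x / w' (W x) \<partial>\<mu>) + b / w 1 * (LINT x:{x. norm x \<le> R}|\<mu>. (f x)\<^sup>2)"
    unfolding F_def[symmetric] C_def B_def by auto
qed

end

section \<open>Poincare inequalities\<close>

lemma mono_on_deriv_nonneg:
  fixes \<phi> :: "real \<Rightarrow> real"
  assumes "mono_on {a..} \<phi>" "(\<phi> has_real_derivative d) (at u within {a..})" "u \<ge> a"
  shows "0 \<le> d"
proof -
  have "((\<lambda>y. (\<phi> y - \<phi> u) / (y - u)) \<longlongrightarrow> d) (at_right u)"
    unfolding has_field_derivative_iff[symmetric]
    by (rule DERIV_subset[OF assms(2)]) (use assms(3) in auto)
  moreover have "\<forall>\<^sub>F y in at_right u. 0 \<le> (\<phi> y - \<phi> u) / (y - u)"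
    using assms(1,3) by (auto simp: eventually_at_filter mono_on_def intro!: always_eventually divide_nonneg_pos)
  ultimately show ?thesis
    by (rule tendsto_lowerbound) simp
qed

text \<open>The upper bound \<open>K\<close> excludes the value \<infinity>. Excluding -\<infinity>
  uses that the measure is not zero, through the essential supremum of a constant.\<close>

lemma (in prob_space) esssup_bounded:
  fixes f :: "'a \<Rightarrow> real"
  assumes [measurable]: "f \<in> borel_measurable M" and K: "\<And>x. \<bar>f x\<bar> \<le> K"
  obtains u where "esssup M (\<lambda>x. ereal (f x)) = ereal u" "AE x in M. f x \<le> u"
proof -
  have "esssup M (\<lambda>x. ereal (f x)) \<le> ereal K"
    using K by (intro esssup_I) (auto simp: abs_le_iff)
  moreover have "ereal (- K) \<le> esssup M (\<lambda>x. ereal (f x))"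
  proof -
    have "esssup M (\<lambda>x. ereal (- K)) \<le> esssup M (\<lambda>x. ereal (f x))"
      by (rule esssup_mono) (use K in \<open>auto simp: abs_le_iff intro: minus_le_iff[THEN iffD1]\<close>)
    then show ?thesis by (simp add: esssup_const emeasure_space_1)
  qed
  ultimately obtain u where u: "esssup M (\<lambda>x. ereal (f x)) = ereal u"
    by (cases "esssup M (\<lambda>x. ereal (f x))") auto
  have "AE x in M. f x \<le> u"
    using esssup_AE[of "\<lambda>x. ereal (f x)" M] unfolding u by simp
  with u show ?thesis by (rule that)
qed

text \<open>\<open>real_of_ereal\<close> sends infinite values to 0, so \<open>Osc\<close> is the
  genuine oscillation only once both essential bounds are known to be finite.\<close>

lemma (in prob_space) Osc_bounded:
  fixes f :: "'a \<Rightarrow> real"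
  assumes f[measurable]: "f \<in> borel_measurable M" and K: "\<And>x. \<bar>f x\<bar> \<le> K"
  obtains l u where "Osc M f = u - l" "AE x in M. l \<le> f x" "AE x in M. f x \<le> u"
proof -
  obtain u where u: "esssup M (\<lambda>x. ereal (f x)) = ereal u" "AE x in M. f x \<le> u"
    using esssup_bounded[OF f K] by blast
  obtain l where l: "esssup M (\<lambda>x. ereal (- f x)) = ereal l" "AE x in M. - f x \<le> l"
    using esssup_bounded[of "\<lambda>x. - f x" K] K by auto
  have "Osc M f = u - (- l)"
    unfolding Osc_def essinf_def using u l by simp
  moreover have "AE x in M. - l \<le> f x" using l(2) by eventually_elim simp
  ultimately show ?thesis using u(2) by (rule that)
qed

context symmetric_diffusion
begin

lemma space_UNIV: "space \<mu> = UNIV"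
  using sets_eq_imp_space_eq[OF sets_eq_borel] by simp

text \<open>Subtracting the average over the ball kills the squared mean in the local inequality and
  leaves the energy unchanged. The second property lets the oscillation of \<open>f\<close> bound |f
  - c|.\<close>

lemma local_average:
  assumes f: "f \<in> \<A>"
    and local_poincare: "\<And>f. f \<in> \<A> \<Longrightarrow>
      (LINT x:{x. norm x \<le> R}|\<mu>. (f x)\<^sup>2) \<le>
        \<kappa> * (\<integral>x. \<Gamma> f f x \<partial>\<mu>)
        + inverse (measure \<mu> {x. norm x \<le> R}) * (LINT x:{x. norm x \<le> R}|\<mu>. f x)\<^sup>2"
  obtains c where "(LINT x:{x. norm x \<le> R}|\<mu>. (f x - c)\<^sup>2) \<le> \<kappa> * (\<integral>x. \<Gamma> f f x \<partial>\<mu>)"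
    "\<forall>l u. (AE x in \<mu>. l \<le> f x) \<longrightarrow> (AE x in \<mu>. f x \<le> u) \<longrightarrow> l \<le> c \<and> c \<le> u"
proof -
  define B where "B = {x :: real ^ 'n. norm x \<le> R}"
  have B[measurable]: "B \<in> sets \<mu>" unfolding B_def by (rule ball_sets)
  have fi: "integrable \<mu> f" by (rule alg_integrable[OF f])
  have indB: "integrable \<mu> (\<lambda>x. indicator B x * k :: real)" for k
    by (rule integrable_const_bound[where B="\<bar>k\<bar>"]) (auto simp: indicator_def)
  have fB: "integrable \<mu> (\<lambda>x. indicator B x * f x)"
    using integrable_real_mult_indicator[OF B fi] by (simp add: mult.commute)
  have int_c: "(LINT x:B|\<mu>. k) = k * measure \<mu> B" for k :: real
    unfolding set_lebesgue_integral_def by simp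
  \<comment> \<open>On a null ball the mean term vanishes for every \<open>c\<close> because
    \<open>inverse 0 = 0\<close>. The global mean is then chosen so that \<open>c\<close> still lies
    between the essential bounds.\<close>
  define c where "c = (if measure \<mu> B = 0 then \<integral>x. f x \<partial>\<mu> else (LINT x:B|\<mu>. f x) / measure \<mu> B)"
  have mean: "inverse (measure \<mu> B) * (LINT x:B|\<mu>. f x - c)\<^sup>2 = 0"
  proof (cases "measure \<mu> B = 0")
    case False
    have "(LINT x:B|\<mu>. f x - c) = (LINT x:B|\<mu>. f x) - (LINT x:B|\<mu>. c)"
      unfolding set_lebesgue_integral_def using fB indB[of c]
      by (simp add: right_diff_distrib)
    also have "\<dots> = 0" using False by (simp add: int_c c_def)
    finally show ?thesis by simp
  qed simp
  have fc: "(\<lambda>x. f x - c) \<in> \<A>" by (rule alg_diff[OF f alg_const])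
  have "(\<integral>x. \<Gamma> (\<lambda>y. f y - c) (\<lambda>y. f y - c) x \<partial>\<mu>) = (\<integral>x. \<Gamma> f f x \<partial>\<mu>)"
    by (rule integral_cong_AE[OF gamma_measurable[OF fc fc] gamma_measurable[OF f f] gamma_shift[OF f]])
  with local_poincare[OF fc] mean
  have 1: "(LINT x:{x. norm x \<le> R}|\<mu>. (f x - c)\<^sup>2) \<le> \<kappa> * (\<integral>x. \<Gamma> f f x \<partial>\<mu>)"
    unfolding B_def by simp
  have 2: "l \<le> c \<and> c \<le> u" if l: "AE x in \<mu>. l \<le> f x" and u: "AE x in \<mu>. f x \<le> u" for l u
  proof (cases "measure \<mu> B = 0")
    case True
    then show ?thesis
      using integral_ge_const[OF fi l] integral_le_const[OF fi u] by (simp add: c_def)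
  next
    case False
    then have pos: "measure \<mu> B > 0" using measure_nonneg[of \<mu> B] by linarith
    have "(LINT x:B|\<mu>. l) \<le> (LINT x:B|\<mu>. f x)"
      unfolding set_lebesgue_integral_def real_scaleR_def
      by (rule integral_mono_AE[OF indB fB]) (use l in \<open>eventually_elim, auto intro: mult_left_mono\<close>)
    moreover have "(LINT x:B|\<mu>. f x) \<le> (LINT x:B|\<mu>. u)"
      unfolding set_lebesgue_integral_def real_scaleR_def
      by (rule integral_mono_AE[OF fB indB]) (use u in \<open>eventually_elim, auto intro: mult_left_mono\<close>)
    ultimately show ?thesis using pos by (simp add: c_def int_c field_simps)
  qed
  show ?thesis by (rule that[OF 1]) (use 2 in blast)
qed

lemma Var_le:
  assumes "f \<in> \<A>" shows "Var \<mu> f \<le> (\<integral>x. (f x - c)\<^sup>2 \<partial>\<mu>)"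
proof -
  have f: "integrable \<mu> f" "integrable \<mu> (\<lambda>x. (f x)\<^sup>2)"
    using assms by (auto intro: alg_integrable dom_L2 alg_dom)
  have "(\<integral>x. (f x - c)\<^sup>2 \<partial>\<mu>) = (\<integral>x. (f x)\<^sup>2 - 2 * c * f x + c\<^sup>2 \<partial>\<mu>)"
    by (simp add: power2_diff algebra_simps)
  also have "\<dots> = (\<integral>x. (f x)\<^sup>2 \<partial>\<mu>) - 2 * c * (\<integral>x. f x \<partial>\<mu>) + c\<^sup>2"
    using f by (simp add: prob_space)
  finally have "(\<integral>x. (f x - c)\<^sup>2 \<partial>\<mu>) - Var \<mu> f = ((\<integral>x. f x \<partial>\<mu>) - c)\<^sup>2"
    by (simp add: Var_def power2_diff algebra_simps)
  then show ?thesis by (smt (verit) zero_le_power2)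
qed

text \<open>In \<open>ennreal\<close> we have $1/0=\infty$, whereas $x/0=0$ for reals.\<close>

lemma weighted_energy_finite:
  assumes f: "f \<in> \<A>" and [measurable]: "k \<in> borel_measurable \<mu>" and k: "\<And>x. 0 \<le> k x"
    and fin: "(\<integral>\<^sup>+ x. (1 + 1 / ennreal (k x)) * ennreal (\<Gamma> f f x) \<partial>\<mu>) < \<infinity>"
  shows "AE x in \<mu>. k x = 0 \<longrightarrow> \<Gamma> f f x = 0"
    and "integrable \<mu> (\<lambda>x. \<Gamma> f f x / k x)"
    and "(\<integral>\<^sup>+ x. (1 + 1 / ennreal (k x)) * ennreal (\<Gamma> f f x) \<partial>\<mu>)
      = ennreal ((\<integral>x. \<Gamma> f f x \<partial>\<mu>) + (\<integral>x. \<Gamma> f f x / k x \<partial>\<mu>))"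
proof -
  note [measurable] = gamma_measurable[OF f f]
  have "AE x in \<mu>. (1 + 1 / ennreal (k x)) * ennreal (\<Gamma> f f x) \<noteq> \<infinity>"
    by (rule nn_integral_PInf_AE) (use fin in auto)
  with gamma_nonneg[OF f] show zero: "AE x in \<mu>. k x = 0 \<longrightarrow> \<Gamma> f f x = 0"
  proof eventually_elim
    case (elim x)
    show ?case
    proof
      assume "k x = 0"
      then have "1 + 1 / ennreal (k x) = \<infinity>" by simp
      with elim have "ennreal (\<Gamma> f f x) = 0" by (simp add: ennreal_top_mult split: if_splits)
      then show "\<Gamma> f f x = 0" using elim by (simp add: ennreal_eq_0_iff)
    qed
  qed
  have eq: "AE x in \<mu>. (1 + 1 / ennreal (k x)) * ennreal (\<Gamma> f f x) = ennreal (\<Gamma> f f x + \<Gamma> f f x / k x)"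
    using zero gamma_nonneg[OF f]
  proof eventually_elim
    case (elim x)
    show ?case
    \<comment> \<open>Where \<open>k x = 0\<close> the energy density is 0 and both sides are 0: in
      \<open>ennreal\<close> because \<infinity> * 0 = 0, in the reals because 0/0 = 0.\<close>
    proof (cases "k x = 0")
      case False
      then have pos: "k x > 0" using k[of x] by simp
      have "1 + 1 / ennreal (k x) = ennreal (1 + 1 / k x)"
        using pos by (simp add: divide_ennreal flip: ennreal_1)
      then have "(1 + 1 / ennreal (k x)) * ennreal (\<Gamma> f f x) = ennreal ((1 + 1 / k x) * \<Gamma> f f x)"
        using pos elim by (simp add: ennreal_mult')
      then show ?thesis by (simp add: algebra_simps)
    qed (use elim in simp)
  qed
  have nneg: "AE x in \<mu>. 0 \<le> \<Gamma> f f x + \<Gamma> f f x / k x"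
    using gamma_nonneg[OF f] by eventually_elim (use k in auto)
  have N: "(\<integral>\<^sup>+ x. (1 + 1 / ennreal (k x)) * ennreal (\<Gamma> f f x) \<partial>\<mu>)
      = (\<integral>\<^sup>+ x. ennreal (\<Gamma> f f x + \<Gamma> f f x / k x) \<partial>\<mu>)"
    by (rule nn_integral_cong_AE[OF eq])
  have sum_int: "integrable \<mu> (\<lambda>x. \<Gamma> f f x + \<Gamma> f f x / k x)"
    by (rule integrableI_nonneg[OF _ nneg]) (use fin N in auto)
  show int: "integrable \<mu> (\<lambda>x. \<Gamma> f f x / k x)"
    using Bochner_Integration.integrable_diff[OF sum_int gamma_integrable[OF f f]] by simp
  show "(\<integral>\<^sup>+ x. (1 + 1 / ennreal (k x)) * ennreal (\<Gamma> f f x) \<partial>\<mu>)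
      = ennreal ((\<integral>x. \<Gamma> f f x \<partial>\<mu>) + (\<integral>x. \<Gamma> f f x / k x \<partial>\<mu>))"
    unfolding N nn_integral_eq_integral[OF sum_int nneg]
    using gamma_integrable[OF f f] int by simp
qed

text \<open>The ratio g/W is positive and finite everywhere, so \<open>F\<close> tends to 0 at 0 and
  to 1 at infinity. Only levels strictly below the quantile are treated; the endpoint is reached
  later by a limit in the final inequality.\<close>

lemma quantile_properties:
  assumes [measurable]: "g \<in> borel_measurable \<mu>" "W \<in> borel_measurable \<mu>"
    and g: "\<And>x. g x > 0" and W: "\<And>x. W x > 0" and s: "0 < s" "s < 1"
  defines "F \<equiv> \<lambda>u. measure \<mu> {x. g x < u * W x}"
  shows "quantile_inv F s > 0" and "\<And>u. u < quantile_inv F s \<Longrightarrow> F u \<le> s"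
proof -
  have F_sets: "{x. g x < u * W x} \<in> sets \<mu>" for u
  proof -
    have "{x \<in> space \<mu>. g x < u * W x} \<in> sets \<mu>" by measurable
    then show ?thesis by (simp add: space_UNIV)
  qed
  have sub: "{x. g x < u * W x} \<subseteq> {x. g x < v * W x}" if "u \<le> v" for u v
    using mult_right_mono[OF that less_imp_le[OF W]] by (auto intro: less_le_trans)
  have F_mono: "F u \<le> F v" if "u \<le> v" for u v
    unfolding F_def by (rule finite_measure_mono[OF sub[OF that] F_sets])
  \<comment> \<open>Continuity from below shows that the set defining the quantile is nonempty,
    without which its real infimum would say nothing.\<close>
  have "(\<lambda>n. measure \<mu> {x. g x < real n * W x}) \<longlonglongrightarrow> measure \<mu> (\<Union>n. {x. g x < real n * W x})"
    by (rule finite_Lim_measure_incseq) (use F_sets sub in \<open>auto simp: incseq_def\<close>)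
  moreover have "(\<Union>n. {x. g x < real n * W x}) = space \<mu>"
  proof -
    have "\<exists>n. g x < real n * W x" for x
      using reals_Archimedean3[OF W[of x]] by blast
    then show ?thesis by (auto simp: space_UNIV)
  qed
  ultimately have "(\<lambda>n. F (real n)) \<longlonglongrightarrow> 1" unfolding F_def by (simp add: prob_space)
  from order_tendstoD(1)[OF this s(2)] obtain n where "s < F (real n)"
    using eventually_happens by force
  then have ne: "{u. F u > s} \<noteq> {}" by blast
  \<comment> \<open>Continuity from above yields a positive level at which \<open>F\<close> is still
    below \<open>s\<close>; by monotonicity it is a lower bound of the set.\<close>
  have "(\<lambda>n. measure \<mu> {x. g x < inverse (real (Suc n)) * W x})
      \<longlonglongrightarrow> measure \<mu> (\<Inter>n. {x. g x < inverse (real (Suc n)) * W x})"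
  proof (rule finite_Lim_measure_decseq)
    show "decseq (\<lambda>n. {x. g x < inverse (real (Suc n)) * W x})"
      unfolding decseq_def by (intro allI impI sub le_imp_inverse_le) auto
  qed (use F_sets in auto)
  moreover have "(\<Inter>n. {x. g x < inverse (real (Suc n)) * W x}) = {}"
  proof -
    have "\<exists>n. \<not> g x < inverse (real (Suc n)) * W x" for x
    proof -
      obtain n where "inverse (real (Suc n)) < g x / W x"
        using reals_Archimedean[of "g x / W x"] g[of x] W[of x] by auto
      then show ?thesis using W[of x] by (auto simp: pos_less_divide_eq intro!: exI[of _ n])
    qed
    then show ?thesis by blast
  qed
  ultimately have "(\<lambda>n. F (inverse (real (Suc n)))) \<longlonglongrightarrow> 0" unfolding F_def by simp
  from order_tendstoD(2)[OF this s(1)] obtain m where m: "F (inverse (real (Suc m))) < s"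
    using eventually_happens by force
  have lb: "inverse (real (Suc m)) \<le> u" if "F u > s" for u
  proof (rule ccontr)
    assume "\<not> inverse (real (Suc m)) \<le> u"
    then have "F u \<le> F (inverse (real (Suc m)))" by (intro F_mono) simp
    with m that show False by simp
  qed
  have "inverse (real (Suc m)) \<le> quantile_inv F s"
    unfolding quantile_inv_def by (rule cInf_greatest[OF ne]) (use lb in simp)
  then show "quantile_inv F s > 0"
    by (rule less_le_trans[rotated]) simp
  show "F u \<le> s" if "u < quantile_inv F s" for u
  proof (rule ccontr)
    assume "\<not> F u \<le> s"
    then have "quantile_inv F s \<le> u"
      unfolding quantile_inv_def using lb by (intro cInf_lower bdd_belowI) auto
    with that show False by simp
  qed
qed

end

theorem theorem3p4:
  fixes \<mu> :: "(real ^ 'n) measure"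
    and D \<A> :: "(real ^ 'n \<Rightarrow> real) set"
    and L :: "(real ^ 'n \<Rightarrow> real) \<Rightarrow> real ^ 'n \<Rightarrow> real"
    and \<phi> \<phi>' :: "real \<Rightarrow> real"
    and W LW :: "real ^ 'n \<Rightarrow> real"
    and b R \<kappa> :: real
  assumes diffusion: "symmetric_diffusion \<mu> D \<A> L"
    and phi_deriv: "\<And>u. u \<ge> 1 \<Longrightarrow> (\<phi> has_real_derivative \<phi>' u) (at u within {1..})"
    and phi_C1: "continuous_on {1..} \<phi>'"
    and phi_pos: "\<And>u. u \<ge> 1 \<Longrightarrow> \<phi> u > 0"
    and phi_incr: "mono_on {1..} \<phi>"
    and phi_sublinear: "\<phi> \<in> O[at_top](\<lambda>u. u)"
    and W_ge_1: "\<And>x. W x \<ge> 1"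
    and W_smooth: "smooth_enough \<mu> \<A> L W LW"
    and b_pos: "b > 0"
    and R_pos: "R > 0"
    and lyapunov: "AE x in \<mu>. LW x \<le> - \<phi> (W x) + b * indicator {x. norm x \<le> R} x"
    and local_poincare: "\<And>f. f \<in> \<A> \<Longrightarrow>
      (LINT x:{x. norm x \<le> R}|\<mu>. (f x)\<^sup>2) \<le>
        \<kappa> * (\<integral>x. carre_du_champ L f f x \<partial>\<mu>)
        + inverse (measure \<mu> {x. norm x \<le> R}) * (LINT x:{x. norm x \<le> R}|\<mu>. f x)\<^sup>2"
  shows "(\<forall>f\<in>\<A>. ennreal (Var \<mu> f) \<le>
            ennreal (max (b * \<kappa> / \<phi> 1) 1) *
            (\<integral>\<^sup>+ x. (1 + 1 / ennreal (\<phi>' (W x))) * ennreal (carre_du_champ L f f x) \<partial>\<mu>)) \<and>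
         (\<forall>f\<in>\<A>. (INF c::real. \<integral>x. (f x - c)\<^sup>2 * (\<phi> (W x) / W x) \<partial>\<mu>) \<le>
            (1 + b * \<kappa>) * (\<integral>x. carre_du_champ L f f x \<partial>\<mu>)) \<and>
         (\<exists>C::real. \<forall>s f. 0 < s \<longrightarrow> s < 1 \<longrightarrow> f \<in> \<A> \<longrightarrow>
            Var \<mu> f \<le>
              C / quantile_inv (\<lambda>u. measure \<mu> {x. \<phi> (W x) < u * W x}) s
                * (\<integral>x. carre_du_champ L f f x \<partial>\<mu>)
              + s * (Osc \<mu> f)\<^sup>2)"
proof -
  interpret symmetric_diffusion \<mu> D \<A> L by (rule diffusion)
  have W[measurable]: "W \<in> borel_measurable \<mu>" using W_smooth by (auto simp: smooth_enough_def)
  have phi_cont: "continuous_on {1..} \<phi>" by (rule DERIV_continuous_on[OF phi_deriv]) auto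
  have phi'_nonneg: "0 \<le> \<phi>' u" if "u \<ge> 1" for u
    by (rule mono_on_deriv_nonneg[OF phi_incr phi_deriv[OF that] that])
  have phi_ge: "\<phi> 1 \<le> \<phi> u" if "u \<ge> 1" for u
    using phi_incr that by (auto simp: mono_on_def)
  note [measurable] = borel_measurable_compose_Ici[OF phi_cont W W_ge_1]
    borel_measurable_compose_Ici[OF phi_C1 W W_ge_1]
  have W_pos: "W x > 0" for x using W_ge_1[of x] by linarith
  have phiW_pos: "\<phi> (W x) > 0" for x by (rule phi_pos[OF W_ge_1])
  let ?B = "{x :: real ^ 'n. norm x \<le> R}"
  let ?E = "\<lambda>f. \<integral>x. \<Gamma> f f x \<partial>\<mu>"

  \<comment> \<open>Kept for every \<open>c\<close> satisfying the local estimate, since the weak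
    inequality needs the same bound for a \<open>c\<close> that also lies between the essential
    bounds of \<open>f\<close>.\<close>
  have converse: "integrable \<mu> (\<lambda>x. (f x - c)\<^sup>2 * (\<phi> (W x) / W x))"
      "(\<integral>x. (f x - c)\<^sup>2 * (\<phi> (W x) / W x) \<partial>\<mu>) \<le> (1 + b * \<kappa>) * ?E f"
    if f: "f \<in> \<A>" and c: "(LINT x:?B|\<mu>. (f x - c)\<^sup>2) \<le> \<kappa> * ?E f" for f c
  proof -
    have fc: "(\<lambda>x. f x - c) \<in> \<A>" by (rule alg_diff[OF f alg_const])
    have E: "?E (\<lambda>x. f x - c) = ?E f"
      by (rule integral_cong_AE[OF gamma_measurable[OF fc fc] gamma_measurable[OF f f] gamma_shift[OF f]])
    have *: "integrable \<mu> (\<lambda>x. (f x - c)\<^sup>2 * (\<phi> (W x) / W x))"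
      "(\<integral>x. (f x - c)\<^sup>2 * (\<phi> (W x) / W x) \<partial>\<mu>)
        \<le> (\<integral>x. \<Gamma> (\<lambda>x. f x - c) (\<lambda>x. f x - c) x / 1 \<partial>\<mu>) + b / 1 * (LINT x:?B|\<mu>. (f x - c)\<^sup>2)"
      by (rule lyapunov_weighted[OF fc W_smooth W_ge_1 phi_cont phi_pos _ lyapunov,
            where w="\<lambda>t. t" and w'="\<lambda>_. 1"];
          use b_pos gamma_integrable[OF fc fc] in \<open>auto intro!: derivative_eq_intros\<close>)+
    show "integrable \<mu> (\<lambda>x. (f x - c)\<^sup>2 * (\<phi> (W x) / W x))" by (rule *(1))
    have "b * (LINT x:?B|\<mu>. (f x - c)\<^sup>2) \<le> b * (\<kappa> * ?E f)"
      using b_pos c by (intro mult_left_mono) auto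
    with *(2) E show "(\<integral>x. (f x - c)\<^sup>2 * (\<phi> (W x) / W x) \<partial>\<mu>) \<le> (1 + b * \<kappa>) * ?E f"
      by (simp add: algebra_simps)
  qed

  \<comment> \<open>Weighted inequality, with an energy that may be infinite\<close>
  have weighted: "ennreal (Var \<mu> f) \<le> ennreal (max (b * \<kappa> / \<phi> 1) 1) *
      (\<integral>\<^sup>+ x. (1 + 1 / ennreal (\<phi>' (W x))) * ennreal (\<Gamma> f f x) \<partial>\<mu>)" if f: "f \<in> \<A>" for f
  proof (cases "(\<integral>\<^sup>+ x. (1 + 1 / ennreal (\<phi>' (W x))) * ennreal (\<Gamma> f f x) \<partial>\<mu>) < \<infinity>")
    case False
    \<comment> \<open>The prefactor is at least 1, so an infinite energy makes the right-hand side
      infinite.\<close>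
    then have "(\<integral>\<^sup>+ x. (1 + 1 / ennreal (\<phi>' (W x))) * ennreal (\<Gamma> f f x) \<partial>\<mu>) = \<infinity>"
      by (simp add: not_less top_unique)
    then show ?thesis by (simp add: ennreal_mult_top)
  next
    case True
    note fin = weighted_energy_finite[OF f borel_measurable_compose_Ici[OF phi_C1 W W_ge_1]
        phi'_nonneg[OF W_ge_1] True]
    let ?H = "\<integral>x. \<Gamma> f f x / \<phi>' (W x) \<partial>\<mu>"
    let ?M = "max (b * \<kappa> / \<phi> 1) 1"
    obtain c where c: "(LINT x:?B|\<mu>. (f x - c)\<^sup>2) \<le> \<kappa> * ?E f"
      by (rule local_average[OF f local_poincare])
    have fc: "(\<lambda>x. f x - c) \<in> \<A>" by (rule alg_diff[OF f alg_const])
    have shift: "AE x in \<mu>. \<Gamma> (\<lambda>y. f y - c) (\<lambda>y. f y - c) x / \<phi>' (W x) = \<Gamma> f f x / \<phi>' (W x)"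
      using gamma_shift[OF f, of c] by eventually_elim simp
    note [measurable] = gamma_measurable[OF fc fc] gamma_measurable[OF f f]
    have energy: "integrable \<mu> (\<lambda>x. \<Gamma> (\<lambda>y. f y - c) (\<lambda>y. f y - c) x / \<phi>' (W x))"
      by (rule integrable_cong_AE_imp[OF fin(2)]) (use shift in auto)
    have energy_eq: "(\<integral>x. \<Gamma> (\<lambda>y. f y - c) (\<lambda>y. f y - c) x / \<phi>' (W x) \<partial>\<mu>) = ?H"
      by (rule integral_cong_AE[OF _ _ shift]) auto
    have degen: "AE x in \<mu>. \<phi>' (W x) = 0 \<longrightarrow> \<Gamma> (\<lambda>y. f y - c) (\<lambda>y. f y - c) x = 0"
      using gamma_shift[OF f, of c] fin(1) by eventually_elim simp
    have "(\<integral>x. (f x - c)\<^sup>2 * (\<phi> (W x) / \<phi> (W x)) \<partial>\<mu>)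
        \<le> ?H + b / \<phi> 1 * (LINT x:?B|\<mu>. (f x - c)\<^sup>2)"
      using lyapunov_weighted(2)[OF fc W_smooth W_ge_1 phi_cont phi_pos less_imp_le[OF b_pos] lyapunov
          phi_deriv phi_C1 phi_pos phi_ge phi'_nonneg energy degen]
      unfolding energy_eq by simp
    also have "(\<integral>x. (f x - c)\<^sup>2 * (\<phi> (W x) / \<phi> (W x)) \<partial>\<mu>) = (\<integral>x. (f x - c)\<^sup>2 \<partial>\<mu>)"
      using phiW_pos by (intro Bochner_Integration.integral_cong) (auto simp: less_imp_neq[symmetric])
    finally have "Var \<mu> f \<le> ?H + b / \<phi> 1 * (LINT x:?B|\<mu>. (f x - c)\<^sup>2)"
      using Var_le[OF f, of c] by linarith
    also have "\<dots> \<le> ?H + b / \<phi> 1 * (\<kappa> * ?E f)"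
      using b_pos phi_pos[of 1] by (intro add_left_mono mult_left_mono c) auto
    \<comment> \<open>The weighted energy carries the coefficient 1 and the plain energy
      b\<kappa>/\<phi>(1). Both energies are nonnegative, so the maximum serves as a common
      constant.\<close>
    also have "\<dots> \<le> ?M * ?H + ?M * ?E f"
    proof (rule add_mono)
      have "0 \<le> ?H"
        by (rule integral_nonneg_AE, use gamma_nonneg[OF f] in eventually_elim)
          (simp add: phi'_nonneg[OF W_ge_1])
      from mult_right_mono[OF max.cobounded2 this, of 1 "b * \<kappa> / \<phi> 1"] show "?H \<le> ?M * ?H" by simp
      from mult_right_mono[OF max.cobounded1 integral_gamma_nonneg[OF f], of "b * \<kappa> / \<phi> 1" 1]
      show "b / \<phi> 1 * (\<kappa> * ?E f) \<le> ?M * ?E f" by simp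
    qed
    also have "\<dots> = ?M * (?E f + ?H)" by (simp add: algebra_simps)
    finally show ?thesis
      unfolding fin(3) by (subst ennreal_mult'[symmetric]) (simp add: le_max_iff_disj, rule ennreal_leI)
  qed

  have conv: "(INF c::real. \<integral>x. (f x - c)\<^sup>2 * (\<phi> (W x) / W x) \<partial>\<mu>) \<le> (1 + b * \<kappa>) * ?E f"
    if f: "f \<in> \<A>" for f
  proof -
    obtain c where c: "(LINT x:?B|\<mu>. (f x - c)\<^sup>2) \<le> \<kappa> * ?E f"
      by (rule local_average[OF f local_poincare])
    have "(INF c::real. \<integral>x. (f x - c)\<^sup>2 * (\<phi> (W x) / W x) \<partial>\<mu>) \<le> (\<integral>x. (f x - c)\<^sup>2 * (\<phi> (W x) / W x) \<partial>\<mu>)"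
    proof (rule cINF_lower)
      show "bdd_below (range (\<lambda>c. \<integral>x. (f x - c)\<^sup>2 * (\<phi> (W x) / W x) \<partial>\<mu>))"
        by (rule bdd_belowI[of _ 0]) (use W_pos phiW_pos in \<open>auto intro!: integral_nonneg_AE simp: less_imp_le\<close>)
    qed simp
    also have "\<dots> \<le> (1 + b * \<kappa>) * ?E f" by (rule converse(2)[OF f c])
    finally show ?thesis .
  qed

  \<comment> \<open>Weak inequality, from the converse one and the quantile\<close>
  have weak: "Var \<mu> f \<le> (1 + b * \<kappa>) / quantile_inv (\<lambda>u. measure \<mu> {x. \<phi> (W x) < u * W x}) s * ?E f
      + s * (Osc \<mu> f)\<^sup>2" if s: "0 < s" "s < 1" and f: "f \<in> \<A>" for s f
  proof -
    let ?F = "\<lambda>u. measure \<mu> {x. \<phi> (W x) < u * W x}"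
    define q where "q = quantile_inv ?F s"
    define A where "A = (1 + b * \<kappa>) * ?E f"
    have q: "q > 0" "\<And>u. u < q \<Longrightarrow> ?F u \<le> s"
      using quantile_properties[OF _ _ phiW_pos W_pos s] by (auto simp: q_def)
    note [measurable] = alg_measurable[OF f]
    obtain K where K: "\<And>x. \<bar>f x\<bar> \<le> K" using alg_bounded[OF f] by blast
    obtain l r where osc: "Osc \<mu> f = r - l" "AE x in \<mu>. l \<le> f x" "AE x in \<mu>. f x \<le> r"
      using Osc_bounded[OF alg_measurable[OF f] K] by blast
    obtain c where c: "(LINT x:?B|\<mu>. (f x - c)\<^sup>2) \<le> \<kappa> * ?E f"
        "\<forall>l u. (AE x in \<mu>. l \<le> f x) \<longrightarrow> (AE x in \<mu>. f x \<le> u) \<longrightarrow> l \<le> c \<and> c \<le> u"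
      by (rule local_average[OF f local_poincare])
    have lcr: "l \<le> c" "c \<le> r" using c(2)[rule_format, OF osc(2,3)] by auto
    \<comment> \<open>Both \<open>f x\<close> and \<open>c\<close> lie in the interval between the
      essential bounds, whose length is the oscillation.\<close>
    have dev: "AE x in \<mu>. (f x - c)\<^sup>2 \<le> (Osc \<mu> f)\<^sup>2"
      using osc(2,3)
    proof eventually_elim
      case (elim x)
      then have "\<bar>f x - c\<bar> \<le> \<bar>Osc \<mu> f\<bar>" using lcr osc(1) by linarith
      then show ?case by (simp only: abs_le_square_iff)
    qed
    \<comment> \<open>Cleared of the denominator, the claim is linear in \<open>u\<close>, so it
      passes to the limit at \<open>q\<close> whatever the sign of the first factor.\<close>
    have "(Var \<mu> f - s * (Osc \<mu> f)\<^sup>2) * u \<le> A" if u: "0 < u" "u < q" for u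
    proof -
      define S where "S = {x. \<phi> (W x) < u * W x}"
      have "{x \<in> space \<mu>. \<phi> (W x) < u * W x} \<in> sets \<mu>" by measurable
      then have S[measurable]: "S \<in> sets \<mu>" by (simp add: S_def space_UNIV)
      have indS: "integrable \<mu> (\<lambda>x. (Osc \<mu> f)\<^sup>2 * indicator S x)"
        by (rule integrable_mult_right, rule integrable_const_bound[where B=1]) auto
      have fc: "(\<lambda>x. f x - c) \<in> \<A>" by (rule alg_diff[OF f alg_const])
      have "Var \<mu> f \<le> (\<integral>x. (f x - c)\<^sup>2 \<partial>\<mu>)" by (rule Var_le[OF f])
      \<comment> \<open>Outside \<open>S\<close> the weight \<phi>(W)/W is at least
        \<open>u\<close>, so the first term suffices; on \<open>S\<close>, whose measure is at most
        \<open>s\<close>, the squared oscillation takes over.\<close>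
      also have "\<dots> \<le> (\<integral>x. (f x - c)\<^sup>2 * (\<phi> (W x) / W x) / u + (Osc \<mu> f)\<^sup>2 * indicator S x \<partial>\<mu>)"
      proof (rule integral_mono_AE)
        show "integrable \<mu> (\<lambda>x. (f x - c)\<^sup>2)" by (rule dom_L2[OF alg_dom[OF fc]])
        show "integrable \<mu> (\<lambda>x. (f x - c)\<^sup>2 * (\<phi> (W x) / W x) / u + (Osc \<mu> f)\<^sup>2 * indicator S x)"
          using converse(1)[OF f c(1)] indS by (intro Bochner_Integration.integrable_add integrable_divide_zero)
        show "AE x in \<mu>. (f x - c)\<^sup>2 \<le> (f x - c)\<^sup>2 * (\<phi> (W x) / W x) / u + (Osc \<mu> f)\<^sup>2 * indicator S x"
          using dev
        proof eventually_elim
          case (elim x)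
          show ?case
          proof (cases "x \<in> S")
            case True
            have "0 \<le> (f x - c)\<^sup>2 * (\<phi> (W x) / W x) / u"
              using u W_pos[of x] phiW_pos[of x] by simp
            then show ?thesis using True elim by simp
          next
            case False
            then have "u \<le> \<phi> (W x) / W x" using W_pos[of x] by (simp add: S_def pos_le_divide_eq)
            from mult_left_mono[OF this, of "(f x - c)\<^sup>2"]
            have "(f x - c)\<^sup>2 \<le> (f x - c)\<^sup>2 * (\<phi> (W x) / W x) / u"
              by (subst pos_le_divide_eq[OF u(1)]) simp
            then show ?thesis using False by simp
          qed
        qed
      qed
      also have "\<dots> = (\<integral>x. (f x - c)\<^sup>2 * (\<phi> (W x) / W x) \<partial>\<mu>) / u + (Osc \<mu> f)\<^sup>2 * measure \<mu> S"
        by (subst Bochner_Integration.integral_add[OF integrable_divide_zero[OF converse(1)[OF f c(1)]] indS])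
          (simp_all add: space_UNIV del: divide_divide_eq_left times_divide_eq_right)
      also have "\<dots> \<le> A / u + (Osc \<mu> f)\<^sup>2 * s"
        using converse(2)[OF f c(1)] q(2)[OF u(2)] u(1)
        by (intro add_mono divide_right_mono mult_left_mono) (auto simp: A_def S_def)
      finally show ?thesis using u(1) by (simp add: field_simps)
    qed
    then have ev: "\<forall>\<^sub>F u in at_left q. (Var \<mu> f - s * (Osc \<mu> f)\<^sup>2) * u \<le> A"
      using eventually_at_left_real[OF q(1)] by (auto elim: eventually_mono)
    have "((\<lambda>u. (Var \<mu> f - s * (Osc \<mu> f)\<^sup>2) * u) \<longlongrightarrow> (Var \<mu> f - s * (Osc \<mu> f)\<^sup>2) * q) (at_left q)"
      by (intro tendsto_intros)
    from tendsto_upperbound[OF this ev] have "(Var \<mu> f - s * (Osc \<mu> f)\<^sup>2) * q \<le> A" by simp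
    then show ?thesis using q(1) unfolding q_def[symmetric] A_def by (simp add: field_simps)
  qed
  show ?thesis using weighted conv weak by blast
qed

end
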